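(* Let $R$ be a ring and let $A$, $B$, $C'$ be $n\times n$ matrices over $R$. Suppose that $C'$ differs from the matrix product $C=A\times B$ in at most $k$ entries. Then there is a deterministic algorithm that, given $A$, $B$, $C'$ and $k$, identifies these erroneous entries and corrects them (outputting $C$) in $\tilde{O}(kn^2)$ time.
   Context: Running time is measured in a unit-cost model where each ring operation and elementary operation costs $O(1)$; $\tilde{O}$ suppresses factors polylogarithmic in $n$ and $k$. *)

theory Defs
  imports Complex_Main
begin

text \<open>
  A deterministic unit-cost algebraic RAM over an (abstract) ring 'a.
  There are two unbounded memories: a nat memory (addresses nat, contents nat)
  and a ring memory (addresses nat, contents in 'a).  Ring elements are opaque:
  the only operations on them are ring operations (0, 1, +, -, negation, *,
  the canonical image of a natural number), equality tests, and moving them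
  around (with indirect addressing).  Every instruction costs one unit.
  Programs contain no ring constants, so they are purely syntactic objects.
\<close>

datatype nop = NAdd | NSub | NMul | NDiv | NMod

datatype instr =
    NConst nat nat
  | NOp nop nat nat nat
  | NLoad nat nat
  | NStore nat nat
  | RZero nat
  | ROne nat
  | ROfNat nat nat
  | RAdd nat nat nat
  | RSub nat nat nat
  | RNeg nat nat
  | RMul nat nat nat
  | RLoad nat nat
  | RStore nat nat
  | Jmp nat
  | JLt nat nat nat
  | JEqN nat nat nat
  | JEqR nat nat nat

type_synonym 'a rstate = "nat \<times> (nat \<Rightarrow> nat) \<times> (nat \<Rightarrow> 'a)"

fun nop_sem :: "nop \<Rightarrow> nat \<Rightarrow> nat \<Rightarrow> nat" where
  "nop_sem NAdd x y = x + y"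
| "nop_sem NSub x y = x - y"
| "nop_sem NMul x y = x * y"
| "nop_sem NDiv x y = x div y"
| "nop_sem NMod x y = x mod y"

fun exec_instr :: "instr \<Rightarrow> 'a::ring_1 rstate \<Rightarrow> 'a rstate" where
  "exec_instr (NConst d v) (pc, nm, rm) = (Suc pc, nm(d := v), rm)"
| "exec_instr (NOp f d a b) (pc, nm, rm) = (Suc pc, nm(d := nop_sem f (nm a) (nm b)), rm)"
| "exec_instr (NLoad d a) (pc, nm, rm) = (Suc pc, nm(d := nm (nm a)), rm)"
| "exec_instr (NStore a s) (pc, nm, rm) = (Suc pc, nm(nm a := nm s), rm)"
| "exec_instr (RZero d) (pc, nm, rm) = (Suc pc, nm, rm(d := 0))"
| "exec_instr (ROne d) (pc, nm, rm) = (Suc pc, nm, rm(d := 1))"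
| "exec_instr (ROfNat d a) (pc, nm, rm) = (Suc pc, nm, rm(d := of_nat (nm a)))"
| "exec_instr (RAdd d a b) (pc, nm, rm) = (Suc pc, nm, rm(d := rm a + rm b))"
| "exec_instr (RSub d a b) (pc, nm, rm) = (Suc pc, nm, rm(d := rm a - rm b))"
| "exec_instr (RNeg d a) (pc, nm, rm) = (Suc pc, nm, rm(d := - rm a))"
| "exec_instr (RMul d a b) (pc, nm, rm) = (Suc pc, nm, rm(d := rm a * rm b))"
| "exec_instr (RLoad d a) (pc, nm, rm) = (Suc pc, nm, rm(d := rm (nm a)))"
| "exec_instr (RStore a s) (pc, nm, rm) = (Suc pc, nm, rm(nm a := rm s))"
| "exec_instr (Jmp t) (pc, nm, rm) = (t, nm, rm)"
| "exec_instr (JLt a b t) (pc, nm, rm) = ((if nm a < nm b then t else Suc pc), nm, rm)"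
| "exec_instr (JEqN a b t) (pc, nm, rm) = ((if nm a = nm b then t else Suc pc), nm, rm)"
| "exec_instr (JEqR a b t) (pc, nm, rm) = ((if rm a = rm b then t else Suc pc), nm, rm)"

definition halted :: "instr list \<Rightarrow> 'a rstate \<Rightarrow> bool" where
  "halted P s \<longleftrightarrow> length P \<le> fst s"

definition step :: "instr list \<Rightarrow> 'a::ring_1 rstate \<Rightarrow> 'a rstate" where
  "step P s = (if halted P s then s else exec_instr (P ! fst s) s)"

definition run :: "instr list \<Rightarrow> nat \<Rightarrow> 'a::ring_1 rstate \<Rightarrow> 'a rstate" where
  "run P t s = (step P ^^ t) s"

text \<open>n x n matrices are functions nat => nat => 'a, only entries i,j < n matter.\<close>
definition mat_mult :: "nat \<Rightarrow> (nat \<Rightarrow> nat \<Rightarrow> 'a::ring_1) \<Rightarrow> (nat \<Rightarrow> nat \<Rightarrow> 'a) \<Rightarrow> nat \<Rightarrow> nat \<Rightarrow> 'a" where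
  "mat_mult n A B = (\<lambda>i j. \<Sum>l<n. A i l * B l j)"

definition num_diff :: "nat \<Rightarrow> (nat \<Rightarrow> nat \<Rightarrow> 'a) \<Rightarrow> (nat \<Rightarrow> nat \<Rightarrow> 'a) \<Rightarrow> nat" where
  "num_diff n M N = card {(i, j). i < n \<and> j < n \<and> M i j \<noteq> N i j}"

definition init_state :: "nat \<Rightarrow> nat \<Rightarrow> (nat \<Rightarrow> nat \<Rightarrow> 'a::ring_1) \<Rightarrow> (nat \<Rightarrow> nat \<Rightarrow> 'a)
    \<Rightarrow> (nat \<Rightarrow> nat \<Rightarrow> 'a) \<Rightarrow> 'a rstate" where
  "init_state n k A B C' =
     (0, (\<lambda>x. 0)(0 := n, 1 := k),
      (\<lambda>x. if x < n * n then A (x div n) (x mod n)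
           else if x < 2 * (n * n) then B ((x - n * n) div n) ((x - n * n) mod n)
           else if x < 3 * (n * n) then C' ((x - 2 * (n * n)) div n) ((x - 2 * (n * n)) mod n)
           else 0))"

definition outputs :: "nat \<Rightarrow> 'a rstate \<Rightarrow> (nat \<Rightarrow> nat \<Rightarrow> 'a) \<Rightarrow> bool" where
  "outputs n s C \<longleftrightarrow> (\<forall>i<n. \<forall>j<n. snd (snd s) (i * n + j) = C i j)"

end

theory Submission
  imports Defs "HOL-Computational_Algebra.Primes"
begin

text \<open>
  Let \<open>E = C' - AB\<close>, let \<open>s\<close> be minimal with \<open>k < s\<^sup>2\<close> and \<open>2\<^sup>L \<ge> n + k + 2\<close>.  For a prime \<open>p\<close>, the sums of
  the entries of a row of \<open>E\<close> over the residue classes of the columns mod \<open>p\<close> are obtained with \<open>O(p)\<close>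
  matrix-vector products.  If row \<open>i\<close> has at most \<open>s\<close> errors, then the class of \<open>j\<close> contains an error
  other than \<open>(i, j)\<close> for at most \<open>s L\<close> primes, so for the majority of the primes below
  \<open>M = 8 s L\<^sup>2 + 2\<close> (there are more than \<open>2 s L\<close> of them, by a Chebyshev bound) the sum equals \<open>E i j\<close>.
  Subtracting the majority vote from every entry thus repairs all such rows, and at most \<open>s\<close> rows,
  perhaps spoiled further, remain.  Now every column has at most \<open>s\<close> errors, and the same procedure on
  the columns repairs everything.  The total time is \<open>O(M\<^sup>2 n\<^sup>2)\<close>, which is \<open>k n\<^sup>2\<close> up to logarithms.
\<close>

section \<open>A structured language compiled to the RAM\<close>

text \<open>Primes take the place of random hashing, because two distinct columns collide modulo
  only logarithmically many of them. The square root balances the cost. A row with \<open>s\<close>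
  errors needs about \<open>s\<close> primes of size about \<open>s\<close>, and each residue class
  costs \<open>n^2\<close>, so a phase costs \<open>s^2 * n^2\<close> up to logarithms. A single
  phase with \<open>s = k\<close> would cost \<open>k^2 * n^2\<close>; with \<open>s\<close> near
  the root of \<open>k\<close> the leftover rows are still few enough for a phase of the same size
  along the columns. Which rows failed is never determined, and the second phase does not depend on
  it.\<close>

datatype cond = Lt nat nat | EqN nat nat | EqR nat nat

datatype com =
    Do "instr list"
  | Seq com com (infixr ";;" 60)
  | Cond cond com com
  | For nat nat com

type_synonym 'a mem = "(nat \<Rightarrow> nat) \<times> (nat \<Rightarrow> 'a)"

fun holds :: "cond \<Rightarrow> 'a mem \<Rightarrow> bool" where
  "holds (Lt a b) \<sigma> \<longleftrightarrow> fst \<sigma> a < fst \<sigma> b"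
| "holds (EqN a b) \<sigma> \<longleftrightarrow> fst \<sigma> a = fst \<sigma> b"
| "holds (EqR a b) \<sigma> \<longleftrightarrow> snd \<sigma> a = snd \<sigma> b"

definition eff :: "instr \<Rightarrow> 'a::ring_1 mem \<Rightarrow> 'a mem" where
  "eff i \<sigma> = snd (exec_instr i (0, fst \<sigma>, snd \<sigma>))"

definition set_reg :: "nat \<Rightarrow> nat \<Rightarrow> 'a mem \<Rightarrow> 'a mem" where
  "set_reg x v \<sigma> = ((fst \<sigma>)(x := v), snd \<sigma>)"

lemma set_reg_simps [simp]:
  "fst (set_reg x v \<sigma>) = (fst \<sigma>)(x := v)" "snd (set_reg x v \<sigma>) = snd \<sigma>"
  by (simp_all add: set_reg_def)

text \<open>The number of rounds is fixed on entry and the counter ends at the bound. Compiled loops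
  behave this way when the body writes neither of the two registers, which \<open>wf_com\<close>
  demands.\<close>

primrec sem :: "com \<Rightarrow> 'a::ring_1 mem \<Rightarrow> 'a mem" where
  "sem (Do xs) \<sigma> = fold eff xs \<sigma>"
| "sem (c1 ;; c2) \<sigma> = sem c2 (sem c1 \<sigma>)"
| "sem (Cond b c1 c2) \<sigma> = (if holds b \<sigma> then sem c1 \<sigma> else sem c2 \<sigma>)"
| "sem (For x b c) \<sigma> =
    set_reg x (fst \<sigma> b) (fold (\<lambda>i \<tau>. sem c (set_reg x i \<tau>)) [0..<fst \<sigma> b] \<sigma>)"

text \<open>The summands 3 in the loop, and 1 and 2 in the conditional, are the numbers of jump and
  counter instructions in the compiled code.\<close>

primrec cost :: "com \<Rightarrow> 'a::ring_1 mem \<Rightarrow> nat" where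
  "cost (Do xs) \<sigma> = length xs"
| "cost (c1 ;; c2) \<sigma> = cost c1 \<sigma> + cost c2 (sem c1 \<sigma>)"
| "cost (Cond b c1 c2) \<sigma> = (if holds b \<sigma> then cost c1 \<sigma> + 1 else cost c2 \<sigma> + 2)"
| "cost (For x b c) \<sigma> =
    (\<Sum>i<fst \<sigma> b. cost c (set_reg x i (fold (\<lambda>i \<tau>. sem c (set_reg x i \<tau>)) [0..<i] \<sigma>)) + 3) + 3"

fun code_size :: "com \<Rightarrow> nat" where
  "code_size (Do xs) = length xs"
| "code_size (c1 ;; c2) = code_size c1 + code_size c2"
| "code_size (Cond b c1 c2) = code_size c1 + code_size c2 + 2"
| "code_size (For x b c) = code_size c + 5"

fun jump_if :: "cond \<Rightarrow> nat \<Rightarrow> instr" where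
  "jump_if (Lt a b) t = JLt a b t"
| "jump_if (EqN a b) t = JEqN a b t"
| "jump_if (EqR a b) t = JEqR a b t"

text \<open>Registers 0 and 1 hold the inputs \<open>n\<close> and \<open>k\<close>. The RAM cannot
  add a constant, so every compiled loop takes its increment from this register, which the first
  instruction of the final program sets to 1.\<close>

abbreviation (input) one_reg :: nat where "one_reg \<equiv> 2"

text \<open>Jump targets are absolute, so the compiler takes the start address as its first argument.\<close>

fun compile :: "nat \<Rightarrow> com \<Rightarrow> instr list" where
  "compile a (Do xs) = xs"
| "compile a (c1 ;; c2) = compile a c1 @ compile (a + code_size c1) c2"
| "compile a (Cond b c1 c2) =
    jump_if b (a + code_size c2 + 2) # compile (a + 1) c2 @
    Jmp (a + code_size c1 + code_size c2 + 2) # compile (a + code_size c2 + 2) c1"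
| "compile a (For x b c) =
    [NConst x 0, JLt x b (a + 3), Jmp (a + code_size c + 5)] @ compile (a + 3) c @
    [NOp NAdd x x one_reg, Jmp (a + 1)]"

lemma length_compile [simp]: "length (compile a c) = code_size c"
  by (induction a c rule: compile.induct) auto

text \<open>Stores to computed nat addresses are excluded so that the written registers can be read
  off the syntax; this gives the frame property \<open>fst_sem\<close>.\<close>

fun simple_instr :: "instr \<Rightarrow> bool" where
  "simple_instr (NStore _ _) = False"
| "simple_instr (Jmp _) = False"
| "simple_instr (JLt _ _ _) = False"
| "simple_instr (JEqN _ _ _) = False"
| "simple_instr (JEqR _ _ _) = False"
| "simple_instr _ = True"

fun instr_writes :: "instr \<Rightarrow> nat set" where
  "instr_writes (NConst d _) = {d}"
| "instr_writes (NOp _ d _ _) = {d}"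
| "instr_writes (NLoad d _) = {d}"
| "instr_writes _ = {}"

fun writes :: "com \<Rightarrow> nat set" where
  "writes (Do xs) = \<Union> (set (map instr_writes xs))"
| "writes (c1 ;; c2) = writes c1 \<union> writes c2"
| "writes (Cond b c1 c2) = writes c1 \<union> writes c2"
| "writes (For x b c) = insert x (writes c)"

fun wf_com :: "com \<Rightarrow> bool" where
  "wf_com (Do xs) \<longleftrightarrow> list_all simple_instr xs"
| "wf_com (c1 ;; c2) \<longleftrightarrow> wf_com c1 \<and> wf_com c2"
| "wf_com (Cond b c1 c2) \<longleftrightarrow> wf_com c1 \<and> wf_com c2"
| "wf_com (For x b c) \<longleftrightarrow> wf_com c \<and> x \<noteq> b \<and> x \<notin> writes c \<and> b \<notin> writes c"

lemma eff_simps [simp]: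
  "eff (NConst d v) \<sigma> = ((fst \<sigma>)(d := v), snd \<sigma>)"
  "eff (NOp f d a b) \<sigma> = ((fst \<sigma>)(d := nop_sem f (fst \<sigma> a) (fst \<sigma> b)), snd \<sigma>)"
  "eff (RZero d) \<sigma> = (fst \<sigma>, (snd \<sigma>)(d := 0))"
  "eff (RAdd d a b) \<sigma> = (fst \<sigma>, (snd \<sigma>)(d := snd \<sigma> a + snd \<sigma> b))"
  "eff (RSub d a b) \<sigma> = (fst \<sigma>, (snd \<sigma>)(d := snd \<sigma> a - snd \<sigma> b))"
  "eff (RMul d a b) \<sigma> = (fst \<sigma>, (snd \<sigma>)(d := snd \<sigma> a * snd \<sigma> b))"
  "eff (RLoad d a) \<sigma> = (fst \<sigma>, (snd \<sigma>)(d := snd \<sigma> (fst \<sigma> a)))"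
  "eff (RStore a s) \<sigma> = (fst \<sigma>, (snd \<sigma>)(fst \<sigma> a := snd \<sigma> s))"
  by (cases \<sigma>; simp add: eff_def)+

lemma fst_eff: "simple_instr i \<Longrightarrow> y \<notin> instr_writes i \<Longrightarrow> fst (eff i \<sigma>) y = fst \<sigma> y"
  by (cases i; cases \<sigma>) (auto simp: eff_def)

lemma exec_simple_instr: "simple_instr i \<Longrightarrow> exec_instr i (a, \<sigma>) = (Suc a, eff i \<sigma>)"
  by (cases i; cases \<sigma>) (auto simp: eff_def)

lemma exec_jump [simp]:
  "exec_instr (Jmp t) (a, \<sigma>) = (t, \<sigma>)"
  "exec_instr (JLt x y t) (a, \<sigma>) = (if fst \<sigma> x < fst \<sigma> y then t else Suc a, \<sigma>)"
  by (cases \<sigma>; simp)+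

lemma fst_sem [simp]: "wf_com c \<Longrightarrow> y \<notin> writes c \<Longrightarrow> fst (sem c \<sigma>) y = fst \<sigma> y"
proof (induction c arbitrary: \<sigma>)
  case (Do xs)
  then show ?case
    by (induction xs arbitrary: \<sigma>) (auto simp: fst_eff)
next
  case (For x b c)
  have "fst (fold (\<lambda>i \<tau>. sem c (set_reg x i \<tau>)) xs \<sigma>) y = fst \<sigma> y" for xs
    using For by (induction xs arbitrary: \<sigma>) auto
  then show ?case using For.prems by simp
qed auto

text \<open>The frame is handed to the step and to the exit condition, so an invariant has to
  mention only the ring memory and the registers that really change.\<close>

lemma For_rule:
  assumes "wf_com (For x b c)"
    and "I 0 \<sigma>"
    and step: "\<And>i \<tau>. i < fst \<sigma> b \<Longrightarrow> I i \<tau> \<Longrightarrow> (\<And>y. y \<notin> insert x (writes c) \<Longrightarrow> fst \<tau> y = fst \<sigma> y)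
      \<Longrightarrow> I (Suc i) (sem c (set_reg x i \<tau>))"
    and "\<And>\<tau>. I (fst \<sigma> b) \<tau> \<Longrightarrow> (\<And>y. y \<notin> insert x (writes c) \<Longrightarrow> fst \<tau> y = fst \<sigma> y)
      \<Longrightarrow> Q (set_reg x (fst \<sigma> b) \<tau>)"
  shows "Q (sem (For x b c) \<sigma>)"
proof -
  let ?s = "\<lambda>m. fold (\<lambda>i \<tau>. sem c (set_reg x i \<tau>)) [0..<m] \<sigma>"
  have "m \<le> fst \<sigma> b \<Longrightarrow> I m (?s m) \<and> (\<forall>y. y \<notin> insert x (writes c) \<longrightarrow> fst (?s m) y = fst \<sigma> y)" for m
  proof (induction m)
    case 0
    then show ?case using assms(2) by simp
  next
    case (Suc m)
    then show ?case using step[of m "?s m"] assms(1) by auto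
  qed
  then show ?thesis using assms(4)[of "?s (fst \<sigma> b)"] by simp
qed

section \<open>Static cost bounds\<close>

fun free_bounds :: "com \<Rightarrow> nat set" where
  "free_bounds (Do xs) = {}"
| "free_bounds (c1 ;; c2) = free_bounds c1 \<union> free_bounds c2"
| "free_bounds (Cond b c1 c2) = free_bounds c1 \<union> free_bounds c2"
| "free_bounds (For x b c) = insert b (free_bounds c - {x})"

text \<open>Inside the body the counter \<open>x\<close> stays below \<open>\<beta> b\<close>, hence
  the update of \<open>\<beta>\<close>. The result is a polynomial in the values of the free
  bounds.\<close>

fun cost_bound :: "com \<Rightarrow> (nat \<Rightarrow> nat) \<Rightarrow> nat" where
  "cost_bound (Do xs) \<beta> = length xs"
| "cost_bound (c1 ;; c2) \<beta> = cost_bound c1 \<beta> + cost_bound c2 \<beta>"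
| "cost_bound (Cond b c1 c2) \<beta> = cost_bound c1 \<beta> + cost_bound c2 \<beta> + 2"
| "cost_bound (For x b c) \<beta> = \<beta> b * (cost_bound c (\<beta>(x := \<beta> b)) + 3) + 3"

text \<open>Disjointness keeps the loop bounds constant during the run; a bound that is the counter
  of an enclosing loop is exempt.\<close>

lemma cost_le_cost_bound:
  "wf_com c \<Longrightarrow> free_bounds c \<inter> writes c = {} \<Longrightarrow> (\<And>y. y \<in> free_bounds c \<Longrightarrow> fst \<sigma> y \<le> \<beta> y)
    \<Longrightarrow> cost c \<sigma> \<le> cost_bound c \<beta>"
proof (induction c arbitrary: \<sigma> \<beta>)
  case (Seq c1 c2)
  have "cost c1 \<sigma> \<le> cost_bound c1 \<beta>"
    using Seq.prems by (intro Seq.IH(1)) auto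
  moreover have "cost c2 (sem c1 \<sigma>) \<le> cost_bound c2 \<beta>"
  proof (rule Seq.IH(2))
    fix y assume y: "y \<in> free_bounds c2"
    then have "y \<notin> writes c1" using Seq.prems(2) by auto
    then show "fst (sem c1 \<sigma>) y \<le> \<beta> y" using Seq.prems y by simp
  qed (use Seq.prems in auto)
  ultimately show ?case by simp
next
  case (Cond b c1 c2)
  have "cost c1 \<sigma> \<le> cost_bound c1 \<beta>" "cost c2 \<sigma> \<le> cost_bound c2 \<beta>"
    using Cond.prems by (auto intro!: Cond.IH)
  then show ?case by simp
next
  case (For x b c)
  let ?s = "\<lambda>m. fold (\<lambda>i \<tau>. sem c (set_reg x i \<tau>)) [0..<m] \<sigma>"
  have frame: "y \<notin> insert x (writes c) \<Longrightarrow> fst (?s m) y = fst \<sigma> y" for m y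
    using For.prems(1) by (induction m) auto
  have *: "cost c (set_reg x i (?s i)) \<le> cost_bound c (\<beta>(x := \<beta> b))" if "i < fst \<sigma> b" for i
  proof (rule For.IH)
    show "wf_com c" using For.prems by simp
    show "free_bounds c \<inter> writes c = {}" using For.prems by auto
    fix y assume y: "y \<in> free_bounds c"
    have "fst \<sigma> b \<le> \<beta> b" using For.prems(3) by simp
    moreover have "fst (?s i) y \<le> \<beta> y" if "y \<noteq> x"
    proof -
      have "y \<notin> writes c" using For.prems(2) y that by auto
      then show ?thesis using frame[of y i] For.prems(3)[of y] y that by simp
    qed
    ultimately show "fst (set_reg x i (?s i)) y \<le> (\<beta>(x := \<beta> b)) y"
      using \<open>i < fst \<sigma> b\<close> by auto
  qed
  have "(\<Sum>i<fst \<sigma> b. cost c (set_reg x i (?s i)) + 3) \<le> (\<Sum>i<fst \<sigma> b. cost_bound c (\<beta>(x := \<beta> b)) + 3)"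
    using * by (intro sum_mono) auto
  also have "\<dots> = fst \<sigma> b * (cost_bound c (\<beta>(x := \<beta> b)) + 3)" by simp
  also have "\<dots> \<le> \<beta> b * (cost_bound c (\<beta>(x := \<beta> b)) + 3)"
    using For.prems(3) by (intro mult_right_mono) auto
  finally show ?case by simp
qed auto

section \<open>Correctness of the compiler\<close>

lemma run_0 [simp]: "run P 0 s = s"
  by (simp add: run_def)

lemma run_add: "run P (t + u) s = run P u (run P t s)"
  by (simp add: run_def funpow_add add.commute[of t u])

lemma run_1:
  assumes "P ! a = i" "a < length P"
  shows "run P 1 (a, \<sigma>) = exec_instr i (a, \<sigma>)"
  using assms by (simp add: run_def step_def halted_def)

lemma run_trans:
  "run P t s = s' \<Longrightarrow> run P u s' = s'' \<Longrightarrow> run P (t + u) s = s''"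
  by (simp add: run_add)

definition code_at :: "instr list \<Rightarrow> nat \<Rightarrow> instr list \<Rightarrow> bool" where
  "code_at P a xs \<longleftrightarrow> (\<exists>pre post. P = pre @ xs @ post \<and> length pre = a)"

lemma code_at_append: "code_at P a (xs @ js) \<longleftrightarrow> code_at P a xs \<and> code_at P (a + length xs) js"
proof
  assume "code_at P a (xs @ js)"
  then obtain pre post where "P = pre @ (xs @ js) @ post" "length pre = a"
    by (auto simp: code_at_def)
  then show "code_at P a xs \<and> code_at P (a + length xs) js"
    unfolding code_at_def by (metis append.assoc length_append)
next
  assume "code_at P a xs \<and> code_at P (a + length xs) js"
  then obtain p q p' q' where *: "P = p @ xs @ q" "length p = a" "P = p' @ js @ q'"
    "length p' = a + length xs"
    unfolding code_at_def by blast
  then have "(p @ xs) @ q = p' @ js @ q'" "length (p @ xs) = length p'" by auto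
  then have "q = js @ q'" using append_eq_append_conv by blast
  then show "code_at P a (xs @ js)" using * by (auto simp: code_at_def)
qed

lemma code_at_Cons: "code_at P a (i # xs) \<longleftrightarrow> (a < length P \<and> P ! a = i) \<and> code_at P (Suc a) xs"
proof -
  have "code_at P a [i] \<longleftrightarrow> a < length P \<and> P ! a = i"
  proof
    assume "a < length P \<and> P ! a = i"
    then have "P = take a P @ [i] @ drop (Suc a) P" "length (take a P) = a"
      using id_take_nth_drop by fastforce+
    then show "code_at P a [i]" unfolding code_at_def by blast
  qed (auto simp: code_at_def)
  then show ?thesis using code_at_append[of P a "[i]" xs] by simp
qed

lemma run_Do:
  "list_all simple_instr xs \<Longrightarrow> code_at P a xs
    \<Longrightarrow> run P (length xs) (a, \<sigma>) = (a + length xs, fold eff xs \<sigma>)"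
proof (induction xs arbitrary: a \<sigma>)
  case (Cons i xs)
  then have "run P 1 (a, \<sigma>) = (Suc a, eff i \<sigma>)"
    by (simp only: run_1 code_at_Cons exec_simple_instr list.pred_inject)
  moreover have "run P (length xs) (Suc a, eff i \<sigma>) = (Suc a + length xs, fold eff xs (eff i \<sigma>))"
    using Cons by (simp add: code_at_Cons)
  ultimately show ?case using run_trans by fastforce
qed simp

text \<open>An exact step count, not an upper bound, lets the runs of consecutive pieces be composed
  by adding their times.\<close>

theorem run_compile:
  "wf_com c \<Longrightarrow> one_reg \<notin> writes c \<Longrightarrow> fst \<sigma> one_reg = 1 \<Longrightarrow> code_at P a (compile a c)
    \<Longrightarrow> run P (cost c \<sigma>) (a, \<sigma>) = (a + code_size c, sem c \<sigma>)"
proof (induction c arbitrary: a \<sigma>)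
  case (Do xs)
  then show ?case using run_Do by simp
next
  case (Seq c1 c2)
  then have "run P (cost c1 \<sigma>) (a, \<sigma>) = (a + code_size c1, sem c1 \<sigma>)"
    by (simp add: code_at_append)
  moreover have "run P (cost c2 (sem c1 \<sigma>)) (a + code_size c1, sem c1 \<sigma>)
      = (a + code_size c1 + code_size c2, sem c2 (sem c1 \<sigma>))"
    using Seq.prems by (intro Seq.IH(2)) (auto simp: code_at_append)
  ultimately show ?case using run_trans by fastforce
next
  case (Cond b c1 c2)
  let ?m = "a + code_size c2 + 2"
  have at: "a < length P" "P ! a = jump_if b ?m"
    and c2: "code_at P (a + 1) (compile (a + 1) c2)"
    and jmp: "a + 1 + code_size c2 < length P"
      "P ! (a + 1 + code_size c2) = Jmp (a + code_size c1 + code_size c2 + 2)"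
    and c1: "code_at P ?m (compile ?m c1)"
    using Cond.prems(4) by (auto simp: code_at_append code_at_Cons)
  have br: "run P 1 (a, \<sigma>) = (if holds b \<sigma> then ?m else a + 1, \<sigma>)"
    using at by (cases b; cases \<sigma>) (simp_all only: run_1, auto)
  show ?case
  proof (cases "holds b \<sigma>")
    case True
    have "run P (cost c1 \<sigma>) (?m, \<sigma>) = (?m + code_size c1, sem c1 \<sigma>)"
      using Cond.prems c1 by (intro Cond.IH(1)) auto
    then have "run P (1 + cost c1 \<sigma>) (a, \<sigma>) = (?m + code_size c1, sem c1 \<sigma>)"
      using br True by (intro run_trans) auto
    then show ?thesis using True by (simp add: add.commute add.left_commute)
  next
    case False
    have "run P (cost c2 \<sigma>) (a + 1, \<sigma>) = (a + 1 + code_size c2, sem c2 \<sigma>)"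
      using Cond.prems c2 by (intro Cond.IH(2)) auto
    then have "run P (1 + cost c2 \<sigma>) (a, \<sigma>) = (a + 1 + code_size c2, sem c2 \<sigma>)"
      using br False by (intro run_trans) auto
    moreover have "run P 1 (a + 1 + code_size c2, sem c2 \<sigma>)
        = (a + code_size c1 + code_size c2 + 2, sem c2 \<sigma>)"
      by (simp only: run_1[OF jmp(2,1)] exec_jump)
    ultimately have "run P (1 + cost c2 \<sigma> + 1) (a, \<sigma>)
        = (a + code_size c1 + code_size c2 + 2, sem c2 \<sigma>)"
      by (rule run_trans)
    then show ?thesis using False by (simp add: add.commute add.left_commute)
  qed
next
  case (For x b c)
  let ?s = "\<lambda>m. fold (\<lambda>i \<tau>. sem c (set_reg x i \<tau>)) [0..<m] \<sigma>"
  let ?e = "a + code_size c + 5"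
  have at: "a < length P" "P ! a = NConst x 0" "a + 1 < length P" "P ! (a + 1) = JLt x b (a + 3)"
    "a + 2 < length P" "P ! (a + 2) = Jmp ?e"
    "a + 3 + code_size c < length P" "P ! (a + 3 + code_size c) = NOp NAdd x x one_reg"
    "a + 4 + code_size c < length P" "P ! (a + 4 + code_size c) = Jmp (a + 1)"
    and c: "code_at P (a + 3) (compile (a + 3) c)"
    using For.prems(4) by (auto simp: code_at_append code_at_Cons numeral_eq_Suc)
  have frame: "y \<notin> insert x (writes c) \<Longrightarrow> fst (?s m) y = fst \<sigma> y" for m y
    using For.prems(1) by (induction m) auto
  \<comment> \<open>Invariant at the loop test, address \<open>a + 1\<close>. The leading 1 is the
    \<open>NConst\<close> that clears the counter; together with the failing test and the exit jump
    it makes up the final 3 in \<open>cost\<close>.\<close>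
  have loop: "run P (1 + (\<Sum>i<m. cost c (set_reg x i (?s i)) + 3)) (a, \<sigma>) = (a + 1, set_reg x m (?s m))"
    if "m \<le> fst \<sigma> b" for m
    using that
  proof (induction m)
    case 0
    show ?case using run_1[OF at(2,1), of \<sigma>] by (cases \<sigma>) (simp add: set_reg_def)
  next
    case (Suc m)
    let ?\<tau> = "set_reg x m (?s m)"
    have "fst ?\<tau> b = fst \<sigma> b" using frame[of b m] For.prems(1) by simp
    then have s1: "run P 1 (a + 1, ?\<tau>) = (a + 3, ?\<tau>)"
      using Suc.prems by (simp only: run_1[OF at(4,3)]) simp
    have s2: "run P (cost c ?\<tau>) (a + 3, ?\<tau>) = (a + 3 + code_size c, sem c ?\<tau>)"
    proof (rule For.IH)
      show "fst ?\<tau> one_reg = 1" using frame[of one_reg m] For.prems by auto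
    qed (use For.prems c in auto)
    have s3: "run P 1 (a + 3 + code_size c, sem c ?\<tau>) = (a + 4 + code_size c, set_reg x (Suc m) (?s (Suc m)))"
    proof -
      have "fst (sem c ?\<tau>) x = m" using For.prems by simp
      moreover have "fst (sem c ?\<tau>) one_reg = 1" using frame[of one_reg m] For.prems by auto
      ultimately show ?thesis
        by (simp only: run_1[OF at(8,7)] exec_simple_instr simple_instr.simps) (simp add: set_reg_def)
    qed
    have s4: "run P 1 (a + 4 + code_size c, set_reg x (Suc m) (?s (Suc m)))
        = (a + 1, set_reg x (Suc m) (?s (Suc m)))"
      by (simp only: run_1[OF at(10,9)]) simp
    have "run P ((1 + (\<Sum>i<m. cost c (set_reg x i (?s i)) + 3)) + (1 + (cost c ?\<tau> + (1 + 1)))) (a, \<sigma>)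
        = (a + 1, set_reg x (Suc m) (?s (Suc m)))"
      using Suc by (intro run_trans[OF _ run_trans[OF s1 run_trans[OF s2 run_trans[OF s3 s4]]]]) simp
    moreover have "1 + (\<Sum>i<Suc m. cost c (set_reg x i (?s i)) + 3)
        = (1 + (\<Sum>i<m. cost c (set_reg x i (?s i)) + 3)) + (1 + (cost c ?\<tau> + (1 + 1)))"
      by simp
    ultimately show ?case by (simp only:)
  qed
  let ?\<tau> = "set_reg x (fst \<sigma> b) (?s (fst \<sigma> b))"
  have "fst ?\<tau> b = fst \<sigma> b" using frame[of b] For.prems(1) by simp
  then have "run P 1 (a + 1, ?\<tau>) = (a + 2, ?\<tau>)"
    using For.prems(1) by (simp only: run_1[OF at(4,3)]) simp
  moreover have "run P 1 (a + 2, ?\<tau>) = (?e, ?\<tau>)"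
    by (simp only: run_1[OF at(6,5)]) simp
  ultimately have "run P ((1 + (\<Sum>i<fst \<sigma> b. cost c (set_reg x i (?s i)) + 3)) + (1 + 1)) (a, \<sigma>) = (?e, ?\<tau>)"
    by (intro run_trans[OF loop[OF order_refl]] run_trans)
  moreover have "cost (For x b c) \<sigma>
      = (1 + (\<Sum>i<fst \<sigma> b. cost c (set_reg x i (?s i)) + 3)) + (1 + 1)" by simp
  ultimately show ?case by (simp only: code_size.simps sem.simps add.assoc)
qed

section \<open>Majority votes and primes\<close>

text \<open>The Boyer-Moore vote with state (candidate, surplus). It needs only equality tests,
  since ring elements can be neither ordered nor used as keys.\<close>

definition majority_step :: "'a \<Rightarrow> 'a \<times> nat \<Rightarrow> 'a \<times> nat" where
  "majority_step v st = (if snd st = 0 then (v, 1)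
     else if fst st = v then (fst st, snd st + 1) else (fst st, snd st - 1))"

text \<open>The right side is the surplus, signed by whether the candidate is \<open>x\<close>. An
  element equal to \<open>x\<close> raises both sides by 1; any other lowers the left side by 1 and
  the right side by at most 1. No majority is assumed.\<close>

lemma majority_invariant:
  assumes "snd st = 0"
  shows "2 * int (count_list xs x) - int (length xs)
    \<le> (let r = fold majority_step xs st in if fst r = x then int (snd r) else - int (snd r))"
  using assms
  by (induction xs rule: rev_induct)
    (auto simp: majority_step_def Let_def of_nat_diff split: if_splits)

lemma majority_correct:
  assumes "2 * count_list xs x > length xs" "snd st = 0"
  shows "fst (fold majority_step xs st) = x"
  using majority_invariant[OF assms(2), of xs x] assms(1) by (auto simp: Let_def split: if_splits)

section \<open>A Chebyshev lower bound for the number of primes\<close>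

text \<open>The numbers \<open>1 / (k * (n choose k))\<close> form Leibniz' harmonic triangle, whose recurrence is
  the induction step.\<close>

lemma times_binomial_dvd:
  assumes "\<And>i. 1 \<le> i \<Longrightarrow> i \<le> n \<Longrightarrow> i dvd (D::nat)" "1 \<le> k" "k \<le> n"
  shows "k * (n choose k) dvd D"
proof -
  have "m \<le> n \<Longrightarrow> k \<le> m \<Longrightarrow> k * (m choose k) dvd D" for m
    using assms(2)
  proof (induction k arbitrary: m rule: nat_induct_at_least)
    case base
    then show ?case using assms(1) by simp
  next
    case (Suc k)
    obtain m' where m': "m = Suc m'" using Suc.prems by (cases m) auto
    obtain k' where k': "k = Suc k'" using Suc.hyps by (cases k) auto
    define a b c where "a = Suc k * (m choose Suc k)" and "b = k * (m choose k)"
      and "c = k * (m' choose k)"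
    have a: "a = m * (m' choose k)" unfolding a_def m' by (rule Suc_times_binomial)
    have b: "b = m * (m' choose k')" unfolding b_def m' k' by (rule Suc_times_binomial)
    have "b = c + k * (m' choose k')" by (simp add: b_def c_def m' k' algebra_simps)
    moreover have "a * (k * (m' choose k')) = b * c" by (simp add: a b c_def ac_simps)
    \<comment> \<open>Divided by \<open>a * b * c\<close> this reads 1/c = 1/a + 1/b, the recurrence
      of the triangle.\<close>
    ultimately have rel: "a * b = b * c + a * c" by (metis add.commute distrib_left)
    have "b dvd D" "c dvd D"
      using Suc.IH[of m] Suc.IH[of m'] Suc.prems m' by (auto simp: b_def c_def)
    then obtain x y where D: "D = b * x" "D = c * y" unfolding dvd_def by blast
    have "b * c \<noteq> 0" using Suc.prems Suc.hyps m' by (auto simp: b_def c_def)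
    \<comment> \<open>Cleared of denominators: D/a = D/c - D/b = y - x. Working in the integers
      avoids truncated subtraction.\<close>
    moreover have "int (b * c) * (int a * (int y - int x)) = int (b * c) * int D"
    proof -
      have "int (b * c) * (int a * (int y - int x)) = int a * int b * int (c * y) - int a * int c * int (b * x)"
        by (simp add: algebra_simps)
      also have "\<dots> = (int a * int b - int a * int c) * int D"
        using D by (simp add: algebra_simps)
      also have "int a * int b - int a * int c = int (b * c)"
        using arg_cong[OF rel, of int] by (simp add: algebra_simps)
      finally show ?thesis .
    qed
    ultimately have "int a * (int y - int x) = int D" by simp
    then have "int a dvd int D" by (metis dvd_triv_left)
    then show ?case unfolding a_def by (simp only: int_dvd_int_iff)
  qed
  then show ?thesis using assms(3) by blast
qed

text \<open>\<open>D\<close> is the least common multiple of the numbers up to \<open>2 * m\<close>.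
  It has at most the factor \<open>2 ^ e\<close> per prime, and it is a multiple of
  \<open>m * (2 * m choose m)\<close>, hence at least half of \<open>4 ^ m\<close>; this half
  accounts for the summand 1.\<close>

lemma card_primes_lower_bound:
  assumes "m \<ge> 1" "2 * m \<le> 2 ^ e"
  shows "2 * m \<le> e * card {p. prime p \<and> p \<le> 2 * m} + 1"
proof -
  define S where "S = {p::nat. prime p \<and> p \<le> 2 * m}"
  define g where "g p = (GREATEST a. p ^ a \<le> 2 * m)" for p
  define D where "D = (\<Prod>p\<in>S. p ^ g p)"
  \<comment> \<open>Bounds the exponents, without which \<open>GREATEST\<close> would say
    nothing.\<close>
  have bnd: "a \<le> 2 * m" if "p \<ge> 2" "p ^ a \<le> 2 * m" for p a :: nat
  proof -
    have "a < 2 ^ a" by (rule less_exp)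
    also have "\<dots> \<le> p ^ a" using that(1) by (rule power_mono) simp
    finally show ?thesis using that(2) by simp
  qed
  have fin: "finite S" unfolding S_def by (rule finite_subset[of _ "{..2 * m}"]) auto
  have g: "p ^ g p \<le> 2 * m" if "p \<in> S" for p
    unfolding g_def
    by (rule GreatestI_nat[of _ 0 "2 * m"]) (use that assms(1) bnd[of p] in \<open>auto simp: S_def prime_ge_2_nat\<close>)
  have "i dvd D" if i: "1 \<le> i" "i \<le> 2 * m" for i
  proof (rule multiplicity_le_imp_dvd)
    show "i \<noteq> 0" using i by simp
    fix p :: nat assume p: "prime p"
    have le: "p ^ multiplicity p i \<le> 2 * m"
      using dvd_imp_le[OF multiplicity_dvd[of p i]] i by simp
    show "multiplicity p i \<le> multiplicity p D"
    proof (cases "p \<in> S")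
      case True
      then have "multiplicity p D = g p"
        unfolding D_def by (subst multiplicity_prod_prime_powers) (use fin p in \<open>auto simp: S_def\<close>)
      moreover have "multiplicity p i \<le> g p"
        unfolding g_def by (rule Greatest_le_nat[of _ _ "2 * m"]) (use le bnd[of p] p in \<open>auto simp: prime_ge_2_nat\<close>)
      ultimately show ?thesis by simp
    next
      case False
      then have "\<not> p dvd i" using p i dvd_imp_le[of p i] by (auto simp: S_def)
      then show ?thesis by (simp add: not_dvd_imp_multiplicity_0)
    qed
  qed
  then have "m * (2 * m choose m) dvd D" using assms(1) by (intro times_binomial_dvd) auto
  moreover have "D > 0" unfolding D_def by (rule prod_pos) (auto simp: S_def prime_gt_0_nat)
  ultimately have "m * (2 * m choose m) \<le> D" by (simp add: dvd_imp_le)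
  moreover have "4 ^ m / (2 * real m) \<le> real (2 * m choose m)"
    by (rule central_binomial_lower_bound) (use assms(1) in simp)
  then have "(4::real) ^ m \<le> real (2 * (m * (2 * m choose m)))"
    using assms(1) by (simp add: field_simps)
  then have "(4::nat) ^ m \<le> 2 * (m * (2 * m choose m))"
    by (metis of_nat_le_iff of_nat_numeral of_nat_power)
  ultimately have "(4::nat) ^ m \<le> 2 * D" by linarith
  also have "D \<le> (\<Prod>p\<in>S. 2 ^ e)"
    unfolding D_def by (rule prod_mono) (use g assms(2) in \<open>auto intro: order_trans\<close>)
  also have "(\<Prod>p\<in>S. (2::nat) ^ e) = 2 ^ (e * card S)" by (simp add: power_mult)
  finally have "(2::nat) ^ (2 * m) \<le> 2 ^ (e * card S + 1)" by (simp add: power_mult)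
  then show ?thesis by (simp only: S_def power_increasing_iff one_less_numeral_iff semiring_norm)
qed

section \<open>Collisions modulo primes\<close>

lemma prod_primes_dvd:
  assumes "finite S" "\<forall>p\<in>S. prime p \<and> p dvd (d::nat)"
  shows "\<Prod>S dvd d"
  using assms
proof (induction S)
  case (insert p S)
  have "coprime p (\<Prod>S)"
    by (rule prod_coprime_right) (use insert in \<open>auto intro: primes_coprime\<close>)
  then show ?case using insert by (simp add: divides_mult)
qed simp

text \<open>The product of the prime divisors divides \<open>d\<close>, and each factor is at least
  2.\<close>

lemma card_prime_divisors:
  assumes "0 < d" "d < (2::nat) ^ l"
  shows "finite {p. prime p \<and> p dvd d}" "card {p. prime p \<and> p dvd d} \<le> l"
proof -
  show fin: "finite {p. prime p \<and> p dvd d}" using assms(1) by (simp add: finite_prime_divisors)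
  have "2 ^ card {p. prime p \<and> p dvd d} \<le> (\<Prod>p\<in>{p. prime p \<and> p dvd d}. p)"
    using prod_mono[of "{p. prime p \<and> p dvd d}" "\<lambda>_. 2" "\<lambda>p. p"] by (auto simp: prime_ge_2_nat)
  also have "\<dots> \<le> d"
    using assms(1) prod_primes_dvd[OF fin, of d] by (auto intro!: dvd_imp_le)
  finally have "2 ^ card {p. prime p \<and> p dvd d} < (2::nat) ^ l" using assms(2) by (rule le_less_trans)
  then show "card {p. prime p \<and> p dvd d} \<le> l" by simp
qed

text \<open>A union bound over the errors at positions other than \<open>j\<close>. The value
  \<open>e j\<close> is arbitrary, so correct entries are confirmed by a majority for 0 in the same
  way.\<close>

lemma bucket_majority:
  fixes e :: "nat \<Rightarrow> 'a::ab_group_add"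
  assumes e: "card {i. i < n \<and> e i \<noteq> 0} \<le> s" and n: "n \<le> 2 ^ l" and j: "j < n"
    and ps: "2 * (s * l) < length ps" "distinct ps" "\<forall>p\<in>set ps. prime (p::nat)"
  shows "length ps < 2 * count_list (map (\<lambda>p. \<Sum>i | i < n \<and> i mod p = j mod p. e i) ps) (e j)"
proof -
  define Z where "Z = {i. i < n \<and> e i \<noteq> 0} - {j}"
  \<comment> \<open>The distance of \<open>i\<close> and \<open>j\<close>: a prime puts both into
    one class exactly when it divides this number.\<close>
  define d where "d i = max i j - min i j" for i
  define bad where "bad = (\<Union>i\<in>Z. {p. prime p \<and> p dvd d i})"
  let ?f = "\<lambda>p. \<Sum>i | i < n \<and> i mod p = j mod p. e i"
  have finZ: "finite Z" by (simp add: Z_def)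
  have d: "0 < d i" "d i < 2 ^ l" if "i \<in> Z" for i
    using that n j by (auto simp: Z_def d_def max_def min_def)
  have "card bad \<le> (\<Sum>i\<in>Z. card {p. prime p \<and> p dvd d i})"
    unfolding bad_def by (rule card_UN_le[OF finZ])
  also have "\<dots> \<le> (\<Sum>i\<in>Z. l)" using card_prime_divisors d by (intro sum_mono) auto
  also have "\<dots> \<le> s * l"
  proof -
    have "card Z \<le> card {i. i < n \<and> e i \<noteq> 0}" unfolding Z_def by (rule card_mono) auto
    then show ?thesis using e by simp
  qed
  finally have bad: "card bad \<le> s * l" .
  have finbad: "finite bad" unfolding bad_def using finZ card_prime_divisors(1) d by auto
  have good: "?f p = e j" if p: "p \<in> set ps - bad" for p
  proof -
    have "e i = 0" if "i < n" "i mod p = j mod p" "i \<noteq> j" for i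
    proof (rule ccontr)
      assume "e i \<noteq> 0"
      then have "i \<in> Z" using that by (simp add: Z_def)
      moreover have "p dvd d i"
        using that(2) by (auto simp: d_def max_def min_def mod_eq_dvd_iff_nat)
          (metis mod_eq_dvd_iff_nat nat_le_linear)
      ultimately have "p \<in> bad" using p ps(3) by (auto simp: bad_def)
      then show False using p by simp
    qed
    then have "?f p = (\<Sum>i\<in>{j}. e i)"
      by (intro sum.mono_neutral_right) (use j in auto)
    then show ?thesis by simp
  qed
  have "length ps - s * l \<le> card (set ps) - card bad"
    using bad ps(2) by (simp add: distinct_card)
  also have "\<dots> \<le> card (set ps - bad)" by (rule diff_card_le_card_Diff[OF finbad])
  also have "\<dots> \<le> card (set (filter (\<lambda>p. ?f p = e j) ps))"
    using good by (intro card_mono) auto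
  also have "\<dots> = length (filter (\<lambda>p. ?f p = e j) ps)"
    by (rule distinct_card) (use ps(2) in simp)
  also have "\<dots> = count_list (map ?f ps) (e j)"
    by (simp add: count_list_eq_length_filter filter_map o_def eq_commute)
  finally show ?thesis using ps(1) by linarith
qed

section \<open>The program of one phase\<close>

text \<open>Nat registers: \<open>rA\<close>, \<open>rB\<close>, \<open>rC\<close>, \<open>rY\<close>, \<open>rV\<close> hold base addresses of ring arrays (the two
  factors, the current product, the bucket sums of the right factor, the votes), \<open>rRS\<close> and \<open>rCS\<close> the
  row and column stride of the matrices, \<open>rM\<close> the bound on the moduli, \<open>rQ\<close> the number of primes
  found so far; \<open>rZ\<close> is never written and stays 0.  Ring cells 0 to 3 are scratch.\<close>

abbreviation (input) rN :: nat where "rN \<equiv> 0"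
abbreviation (input) rM :: nat where "rM \<equiv> 3"
abbreviation (input) rZ :: nat where "rZ \<equiv> 4"
abbreviation (input) rA :: nat where "rA \<equiv> 5"
abbreviation (input) rB :: nat where "rB \<equiv> 6"
abbreviation (input) rC :: nat where "rC \<equiv> 7"
abbreviation (input) rY :: nat where "rY \<equiv> 8"
abbreviation (input) rV :: nat where "rV \<equiv> 9"
abbreviation (input) rRS :: nat where "rRS \<equiv> 10"
abbreviation (input) rCS :: nat where "rCS \<equiv> 11"
abbreviation (input) rP :: nat where "rP \<equiv> 12"
abbreviation (input) rR :: nat where "rR \<equiv> 13"
abbreviation (input) rI :: nat where "rI \<equiv> 14"
abbreviation (input) rJ :: nat where "rJ \<equiv> 15"
abbreviation (input) rL :: nat where "rL \<equiv> 16"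
abbreviation (input) rD :: nat where "rD \<equiv> 17"
abbreviation (input) rT :: nat where "rT \<equiv> 18"
abbreviation (input) rQ :: nat where "rQ \<equiv> 19"
abbreviation (input) rF :: nat where "rF \<equiv> 20"
abbreviation (input) rX :: nat where "rX \<equiv> 21"
abbreviation (input) rW :: nat where "rW \<equiv> 22"

abbreviation Skip :: com where "Skip \<equiv> Do []"

abbreviation entry_address :: "nat \<Rightarrow> nat \<Rightarrow> nat \<Rightarrow> instr list" where
  "entry_address base i j \<equiv>
    [NOp NMul rD i rRS, NOp NMul rT j rCS, NOp NAdd rD rD rT, NOp NAdd rD rD base]"

abbreviation vote_address :: "nat \<Rightarrow> instr list" where
  "vote_address q \<equiv> [NOp NMul rD rI rN, NOp NAdd rD rD rJ, NOp NMul rD rD rM, NOp NAdd rD rD q,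
     NOp NAdd rD rD rV]"

text \<open>The second phase works on the transposed matrices, where the factors swap: it runs the same code
  with \<open>f = False\<close>, which reverses the products.\<close>

definition mul_instr :: "bool \<Rightarrow> instr" where
  "mul_instr f = (if f then RMul 3 1 2 else RMul 3 2 1)"

definition mul :: "bool \<Rightarrow> 'a::ring_1 \<Rightarrow> 'a \<Rightarrow> 'a" where
  "mul f x y = (if f then x * y else y * x)"

lemma mul_instr_simps [simp]:
  "eff (mul_instr f) \<sigma> = (fst \<sigma>, (snd \<sigma>)(3 := mul f (snd \<sigma> 1) (snd \<sigma> 2)))"
  "simple_instr (mul_instr f)" "instr_writes (mul_instr f) = {}"
  by (simp_all add: mul_instr_def mul_def)

definition bucket_sum :: "nat \<Rightarrow> nat \<Rightarrow> com" where
  "bucket_sum base i = Do [RZero 0] ;;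
    For rJ rN (Do [NOp NMod rT rJ rP] ;;
      Cond (EqN rT rR) (Do (entry_address base i rJ @ [RLoad 1 rD, RAdd 0 0 1])) Skip)"

definition dot :: "bool \<Rightarrow> com" where
  "dot f = For rL rN (Do (entry_address rA rI rL @
    [RLoad 1 rD, NOp NAdd rD rL rY, RLoad 2 rD, mul_instr f, RSub 0 0 3]))"

text \<open>A bucket sum is a vote for every column of its class. Each matrix entry owns
  \<open>rM\<close> consecutive slots, and \<open>rQ\<close> selects the one of the current
  prime.\<close>

definition bucket_store :: com where
  "bucket_store = For rJ rN (Do [NOp NMod rT rJ rP] ;;
    Cond (EqN rT rR) (Do (vote_address rQ @ [RStore rD 0])) Skip)"

text \<open>With v the indicator vector of the class, the bucket sums of C' - A B are computed as C'
  v - A (B v). The product A B is never formed, and a class costs O(n^2).\<close>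

definition bucket :: "bool \<Rightarrow> com" where
  "bucket f = For rL rN (bucket_sum rB rL ;; Do [NOp NAdd rD rL rY, RStore rD 0]) ;;
    For rI rN (bucket_sum rC rI ;; dot f ;; bucket_store)"

text \<open>Trial division is affordable: all candidates below M together cost O(M^2).\<close>

definition prime_test :: com where
  "prime_test = Do [NConst rF 1, NConst rT 2] ;; Cond (Lt rP rT) (Do [NConst rF 0]) Skip ;;
    For rX rP (Cond (Lt one_reg rX)
      (Do [NOp NMod rT rP rX] ;; Cond (EqN rT rZ) (Do [NConst rF 0]) Skip) Skip)"

definition collect_votes :: "bool \<Rightarrow> com" where
  "collect_votes f = Do [NConst rQ 0] ;;
    For rP rM (prime_test ;;
      Cond (EqN rF one_reg) (For rR rP (bucket f) ;; Do [NOp NAdd rQ rQ one_reg]) Skip)"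

text \<open>The loop runs to \<open>rM\<close> under a guard instead of to \<open>rQ\<close>,
  because \<open>rQ\<close> is written during the phase and the static cost bound admits only
  unwritten free loop bounds. \<open>RZero\<close> followed by \<open>RAdd\<close> copies cell 1 to
  cell 0; the RAM has no direct move.\<close>

definition majority :: com where
  "majority = Do [NConst rW 0, RZero 0] ;;
    For rX rM (Cond (Lt rX rQ)
      (Do (vote_address rX @ [RLoad 1 rD]) ;;
       Cond (EqN rW rZ) (Do [RZero 0, RAdd 0 0 1, NConst rW 1])
         (Cond (EqR 0 1) (Do [NOp NAdd rW rW one_reg]) (Do [NOp NSub rW rW one_reg])))
      Skip)"

definition apply_votes :: com where
  "apply_votes = For rI rN (For rJ rN (majority ;;
    Do (entry_address rC rI rJ @ [RLoad 1 rD, RSub 1 1 0, RStore rD 1])))"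

definition phase :: "bool \<Rightarrow> com" where
  "phase f = collect_votes f ;; apply_votes"

lemma wf_bucket_sum [simp]: "base \<notin> {rJ, rT, rD} \<Longrightarrow> i \<notin> {rJ, rT, rD} \<Longrightarrow> wf_com (bucket_sum base i)"
  and writes_bucket_sum [simp]: "writes (bucket_sum base i) = {rJ, rT, rD}"
  by (auto simp: bucket_sum_def)

lemma wf_dot [simp]: "wf_com (dot f)"
  and writes_dot [simp]: "writes (dot f) = {rL, rT, rD}"
  by (auto simp: dot_def)

lemma wf_bucket_store [simp]: "wf_com bucket_store"
  and writes_bucket_store [simp]: "writes bucket_store = {rJ, rT, rD}"
  by (auto simp: bucket_store_def)

lemma wf_bucket [simp]: "wf_com (bucket f)"
  and writes_bucket [simp]: "writes (bucket f) = {rL, rI, rJ, rT, rD}"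
  by (auto simp: bucket_def)

lemma wf_prime_test [simp]: "wf_com prime_test"
  and writes_prime_test [simp]: "writes prime_test = {rF, rT, rX}"
  by (auto simp: prime_test_def)

lemma wf_collect_votes [simp]: "wf_com (collect_votes f)"
  and writes_collect_votes [simp]:
    "writes (collect_votes f) = {rQ, rP, rF, rX, rR, rL, rI, rJ, rT, rD}"
  by (auto simp: collect_votes_def)

lemma wf_majority [simp]: "wf_com majority"
  and writes_majority [simp]: "writes majority = {rW, rX, rD}"
  by (auto simp: majority_def)

lemma wf_apply_votes [simp]: "wf_com apply_votes"
  and writes_apply_votes [simp]: "writes apply_votes = {rI, rJ, rW, rX, rD, rT}"
  by (auto simp: apply_votes_def)

lemma wf_phase [simp]: "wf_com (phase f)"
  and writes_phase [simp]:
    "writes (phase f) = {rQ, rP, rF, rX, rR, rL, rI, rJ, rT, rD, rW}"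
  by (auto simp: phase_def)

section \<open>Effect of the program pieces on the memory\<close>

lemma bucket_sum_spec:
  fixes \<sigma> :: "'a::ring_1 mem"
  assumes "base \<notin> {rJ, rT, rD}" "i \<notin> {rJ, rT, rD}" "4 \<le> fst \<sigma> base"
  defines "\<sigma>' \<equiv> sem (bucket_sum base i) \<sigma>"
  shows "snd \<sigma>' 0 = (\<Sum>j<fst \<sigma> rN. if j mod fst \<sigma> rP = fst \<sigma> rR
      then snd \<sigma> (fst \<sigma> i * fst \<sigma> rRS + j * fst \<sigma> rCS + fst \<sigma> base) else 0)" (is "_ = ?S (fst \<sigma> rN)")
    and "4 \<le> a \<Longrightarrow> snd \<sigma>' a = snd \<sigma> a"
proof -
  have "snd \<sigma>' 0 = ?S (fst \<sigma> rN) \<and> (\<forall>a\<ge>4. snd \<sigma>' a = snd \<sigma> a)"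
    unfolding \<sigma>'_def bucket_sum_def sem.simps(2)
  proof (rule For_rule[where I = "\<lambda>m \<tau>. snd \<tau> 0 = ?S m \<and> (\<forall>a\<ge>4. snd \<tau> a = snd \<sigma> a)"], goal_cases)
    case 1
    then show ?case using assms by auto
  next
    case 2
    then show ?case by auto
  next
    case (3 m \<tau>)
    then show ?case using assms by auto
  next
    case (4 \<tau>)
    then show ?case by auto
  qed
  then show "snd \<sigma>' 0 = ?S (fst \<sigma> rN)" "4 \<le> a \<Longrightarrow> snd \<sigma>' a = snd \<sigma> a" by auto
qed

lemma dot_spec:
  fixes \<sigma> :: "'a::ring_1 mem" and f :: bool
  assumes "4 \<le> fst \<sigma> rA" "4 \<le> fst \<sigma> rY"
  defines "\<sigma>' \<equiv> sem (dot f) \<sigma>"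
  shows "snd \<sigma>' 0 = snd \<sigma> 0 - (\<Sum>l<fst \<sigma> rN. mul f
      (snd \<sigma> (fst \<sigma> rI * fst \<sigma> rRS + l * fst \<sigma> rCS + fst \<sigma> rA)) (snd \<sigma> (l + fst \<sigma> rY)))"
      (is "_ = _ - ?S (fst \<sigma> rN)")
    and "4 \<le> a \<Longrightarrow> snd \<sigma>' a = snd \<sigma> a"
proof -
  have "snd \<sigma>' 0 = snd \<sigma> 0 - ?S (fst \<sigma> rN) \<and> (\<forall>a\<ge>4. snd \<sigma>' a = snd \<sigma> a)"
    unfolding \<sigma>'_def dot_def
  proof (rule For_rule[where I = "\<lambda>m \<tau>. snd \<tau> 0 = snd \<sigma> 0 - ?S m \<and> (\<forall>a\<ge>4. snd \<tau> a = snd \<sigma> a)"], goal_cases)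
    case 1
    then show ?case using assms by auto
  next
    case 2
    then show ?case by auto
  next
    case (3 m \<tau>)
    then show ?case using assms by (auto simp: algebra_simps)
  next
    case (4 \<tau>)
    then show ?case by auto
  qed
  then show "snd \<sigma>' 0 = snd \<sigma> 0 - ?S (fst \<sigma> rN)" "4 \<le> a \<Longrightarrow> snd \<sigma>' a = snd \<sigma> a" by auto
qed

text \<open>The existential form needs no injectivity of the slot addresses, which enters only with
  the layout. A vote area beyond the scratch cells keeps the source, cell 0, intact during the
  loop.\<close>

lemma bucket_store_spec:
  fixes \<sigma> :: "'a::ring_1 mem"
  assumes "4 \<le> fst \<sigma> rV"
  shows "snd (sem bucket_store \<sigma>) = (\<lambda>a. if \<exists>j<fst \<sigma> rN. j mod fst \<sigma> rP = fst \<sigma> rR \<and>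
      a = (fst \<sigma> rI * fst \<sigma> rN + j) * fst \<sigma> rM + fst \<sigma> rQ + fst \<sigma> rV then snd \<sigma> 0 else snd \<sigma> a)"
  unfolding bucket_store_def
proof (rule For_rule[where I = "\<lambda>m \<tau>. snd \<tau> = (\<lambda>a. if \<exists>j<m. j mod fst \<sigma> rP = fst \<sigma> rR \<and>
      a = (fst \<sigma> rI * fst \<sigma> rN + j) * fst \<sigma> rM + fst \<sigma> rQ + fst \<sigma> rV then snd \<sigma> 0 else snd \<sigma> a)"], goal_cases)
  case 1
  then show ?case by auto
next
  case 2
  then show ?case by auto
next
  case (3 m \<tau>)
  then show ?case using assms by (auto simp: less_Suc_eq fun_eq_iff)
next
  case (4 \<tau>)
  then show ?case by auto
qed

lemma prime_test_spec:
  fixes \<sigma> :: "'a::ring_1 mem"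
  assumes "fst \<sigma> one_reg = 1" "fst \<sigma> rZ = 0"
  defines "\<sigma>' \<equiv> sem prime_test \<sigma>"
  shows "snd \<sigma>' = snd \<sigma>" "fst \<sigma>' rF = (if prime (fst \<sigma> rP) then 1 else 0)"
proof -
  let ?p = "fst \<sigma> rP"
  let ?I = "\<lambda>m \<tau>. snd \<tau> = snd \<sigma> \<and> fst \<tau> rF = (if 2 \<le> ?p \<and> (\<forall>d. 2 \<le> d \<longrightarrow> d < m \<longrightarrow> \<not> d dvd ?p) then 1 else 0)"
  have "?I ?p \<sigma>'"
    unfolding \<sigma>'_def prime_test_def sem.simps(2)
  proof (rule For_rule[where I = ?I], goal_cases)
    case 1
    then show ?case by auto
  next
    case 2
    then show ?case by auto
  next
    case (3 m \<tau>)
    have "(\<forall>d. 2 \<le> d \<longrightarrow> d < Suc m \<longrightarrow> \<not> d dvd ?p) \<longleftrightarrow>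
        (\<forall>d. 2 \<le> d \<longrightarrow> d < m \<longrightarrow> \<not> d dvd ?p) \<and> (1 < m \<longrightarrow> \<not> m dvd ?p)"
      by (simp add: less_Suc_eq numeral_2_eq_2 Suc_le_eq) blast
    then show ?case using 3 assms by (auto simp: mod_eq_0_iff_dvd)
  next
    case (4 \<tau>)
    then show ?case by auto
  qed
  moreover have "2 \<le> ?p \<and> (\<forall>d. 2 \<le> d \<longrightarrow> d < ?p \<longrightarrow> \<not> d dvd ?p) \<longleftrightarrow> prime ?p"
    by (auto simp: prime_nat_iff')
  ultimately show "snd \<sigma>' = snd \<sigma>" "fst \<sigma>' rF = (if prime (fst \<sigma> rP) then 1 else 0)" by auto
qed

lemma majority_spec:
  fixes \<sigma> :: "'a::ring_1 mem"
  assumes "fst \<sigma> one_reg = 1" "fst \<sigma> rZ = 0" "4 \<le> fst \<sigma> rV" "fst \<sigma> rQ \<le> fst \<sigma> rM"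
  defines "\<sigma>' \<equiv> sem majority \<sigma>"
  shows "snd \<sigma>' 0 = fst (fold majority_step (map (\<lambda>q. snd \<sigma>
      ((fst \<sigma> rI * fst \<sigma> rN + fst \<sigma> rJ) * fst \<sigma> rM + q + fst \<sigma> rV)) [0..<fst \<sigma> rQ]) (0, 0))"
    (is "_ = fst (?S (fst \<sigma> rQ))")
    and "4 \<le> a \<Longrightarrow> snd \<sigma>' a = snd \<sigma> a"
proof -
  have "fst (?S (fst \<sigma> rQ)) = snd \<sigma>' 0 \<and> (\<forall>a\<ge>4. snd \<sigma>' a = snd \<sigma> a)"
    unfolding \<sigma>'_def majority_def sem.simps(2)
  \<comment> \<open>Rounds from \<open>rQ\<close> on are idle, hence the minimum. Cell 0 and
    \<open>rW\<close> together hold the state of \<open>majority_step\<close>.\<close>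
  proof (rule For_rule[where I = "\<lambda>m \<tau>. ?S (min m (fst \<sigma> rQ)) = (snd \<tau> 0, fst \<tau> rW) \<and> (\<forall>a\<ge>4. snd \<tau> a = snd \<sigma> a)"], goal_cases)
    case 1
    then show ?case by auto
  next
    case 2
    then show ?case by auto
  next
    case (3 m \<tau>)
    show ?case
    proof (cases "m < fst \<sigma> rQ")
      case True
      then have "min m (fst \<sigma> rQ) = m" "min (Suc m) (fst \<sigma> rQ) = Suc m" by auto
      then show ?thesis using 3 True assms by (auto simp: majority_step_def)
    next
      case False
      then have "min m (fst \<sigma> rQ) = fst \<sigma> rQ" "min (Suc m) (fst \<sigma> rQ) = fst \<sigma> rQ" by auto
      then show ?thesis using 3 False by auto
    qed
  next
    case (4 \<tau>)
    then show ?case using assms by auto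
  qed
  then show "snd \<sigma>' 0 = fst (?S (fst \<sigma> rQ))" "4 \<le> a \<Longrightarrow> snd \<sigma>' a = snd \<sigma> a" by auto
qed

section \<open>Correctness of a phase\<close>

lemma mult_add_inject:
  fixes a b :: nat
  assumes "a * m + x = b * m + y" "x < m" "y < m"
  shows "a = b \<and> x = y"
proof -
  have "(a * m + x) div m = a" "(b * m + y) div m = b" using assms(2,3) by simp_all
  then have "a = b" using assms(1) by simp
  then show ?thesis using assms(1) by simp
qed

lemma mult_add_less: "i < n \<Longrightarrow> j < m \<Longrightarrow> i * m + j < n * (m::nat)"
proof -
  assume "i < n" "j < m"
  then have "i * m + j < Suc i * m" by simp
  also have "\<dots> \<le> n * m" using \<open>i < n\<close> by (intro mult_right_mono) auto
  finally show ?thesis .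
qed

lemma mul_sum_right: "mul f x (\<Sum>j\<in>S. g j) = (\<Sum>j\<in>S. mul f x (g j))"
  by (simp add: mul_def sum_distrib_left sum_distrib_right)

lemma mul_if_right: "mul f x (if b then y else 0) = (if b then mul f x y else 0)"
  by (simp add: mul_def)

definition primes_below :: "nat \<Rightarrow> nat list" where
  "primes_below m = filter prime [0..<m]"

lemma primes_below_Suc: "primes_below (Suc m) = primes_below m @ (if prime m then [m] else [])"
  by (simp add: primes_below_def)

lemma length_primes_below: "length (primes_below m) \<le> m"
  using length_filter_le[of prime "[0..<m]"] by (simp add: primes_below_def)

text \<open>The two strides describe row-major storage and its transpose. The areas of the two
  factors are only read and exchange their roles between the phases, so no order between
  \<open>bA\<close> and \<open>bB\<close> is imposed. The vote area lies last and is
  open-ended.\<close>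

locale layout =
  fixes n M RS CS bA bB bC bY bV :: nat
  assumes stride: "RS = n \<and> CS = 1 \<or> RS = 1 \<and> CS = n"
    and bases: "4 \<le> bA" "4 \<le> bB" "bA + n * n \<le> bC" "bB + n * n \<le> bC" "bC + n * n \<le> bY"
      "bY + n \<le> bV"
begin

definition regs :: "'a mem \<Rightarrow> bool" where
  "regs \<sigma> \<longleftrightarrow> fst \<sigma> rN = n \<and> fst \<sigma> one_reg = 1 \<and> fst \<sigma> rM = M \<and> fst \<sigma> rZ = 0 \<and> fst \<sigma> rA = bA \<and>
    fst \<sigma> rB = bB \<and> fst \<sigma> rC = bC \<and> fst \<sigma> rY = bY \<and> fst \<sigma> rV = bV \<and> fst \<sigma> rRS = RS \<and> fst \<sigma> rCS = CS"

definition off :: "nat \<Rightarrow> nat \<Rightarrow> nat" where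
  "off i j = i * RS + j * CS"

definition vaddr :: "nat \<Rightarrow> nat \<Rightarrow> nat \<Rightarrow> nat" where
  "vaddr i j q = (i * n + j) * M + q + bV"

lemma off_less: "i < n \<Longrightarrow> j < n \<Longrightarrow> off i j < n * n"
  using stride mult_add_less[of i n j n] mult_add_less[of j n i n] by (auto simp: off_def)

lemma off_inject: "i < n \<Longrightarrow> j < n \<Longrightarrow> i' < n \<Longrightarrow> j' < n \<Longrightarrow> off i j = off i' j' \<longleftrightarrow> i = i' \<and> j = j'"
  using stride mult_add_inject[of i n j i' j'] mult_add_inject[of j n i j' i'] by (auto simp: off_def)

lemma vaddr_inject:
  assumes "j < n" "j' < n" "q < M" "q' < M"
  shows "vaddr i j q = vaddr i' j' q' \<longleftrightarrow> i = i' \<and> j = j' \<and> q = q'"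
  using mult_add_inject[of "i * n + j" M q "i' * n + j'" q'] mult_add_inject[of i n j i' j'] assms
  by (auto simp: vaddr_def)

lemma bV_le_vaddr: "bV \<le> vaddr i j q"
  by (simp add: vaddr_def)

definition mats :: "'a mem \<Rightarrow> (nat \<Rightarrow> nat \<Rightarrow> 'a) \<Rightarrow> (nat \<Rightarrow> nat \<Rightarrow> 'a) \<Rightarrow> (nat \<Rightarrow> nat \<Rightarrow> 'a) \<Rightarrow> bool" where
  "mats \<sigma> A B C \<longleftrightarrow> (\<forall>i<n. \<forall>j<n. snd \<sigma> (off i j + bA) = A i j \<and> snd \<sigma> (off i j + bB) = B i j
     \<and> snd \<sigma> (off i j + bC) = C i j)"

lemma mats_cong:
  assumes "mats \<sigma> A B C" "\<And>a. 4 \<le> a \<Longrightarrow> a < bY \<Longrightarrow> snd \<tau> a = snd \<sigma> a"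
  shows "mats \<tau> A B C"
proof -
  have "4 \<le> off i j + bA \<and> off i j + bA < bY \<and> 4 \<le> off i j + bB \<and> off i j + bB < bY \<and>
      4 \<le> off i j + bC \<and> off i j + bC < bY" if "i < n" "j < n" for i j
    using off_less[OF that] bases by linarith
  then show ?thesis using assms by (auto simp: mats_def)
qed

definition err :: "bool \<Rightarrow> (nat \<Rightarrow> nat \<Rightarrow> 'a::ring_1) \<Rightarrow> (nat \<Rightarrow> nat \<Rightarrow> 'a) \<Rightarrow> (nat \<Rightarrow> nat \<Rightarrow> 'a) \<Rightarrow> nat \<Rightarrow> nat \<Rightarrow> 'a" where
  "err f A B C i j = C i j - (\<Sum>l<n. mul f (A i l) (B l j))"

text \<open>Associativity of C v - A (B v) = (C - A B) v for an indicator vector v. Exchanging the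
  sums suffices, in either order of multiplication.\<close>

lemma err_bucket:
  "(\<Sum>j<n. if j mod p = r then C i j else 0)
     - (\<Sum>l<n. mul f (A i l) (\<Sum>j<n. if j mod p = r then B l j else 0))
   = (\<Sum>j<n. if j mod p = r then err f A B C i j else 0)"
proof -
  have "(\<Sum>l<n. mul f (A i l) (\<Sum>j<n. if j mod p = r then B l j else 0))
      = (\<Sum>j<n. \<Sum>l<n. mul f (A i l) (if j mod p = r then B l j else 0))"
    unfolding mul_sum_right by (rule sum.swap)
  also have "\<dots> = (\<Sum>j<n. if j mod p = r then \<Sum>l<n. mul f (A i l) (B l j) else 0)"
    by (rule sum.cong) (auto simp: mul_if_right)
  finally have eq: "(\<Sum>l<n. mul f (A i l) (\<Sum>j<n. if j mod p = r then B l j else 0))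
      = (\<Sum>j<n. if j mod p = r then \<Sum>l<n. mul f (A i l) (B l j) else 0)" .
  show ?thesis
    unfolding eq unfolding sum_subtractf[symmetric] by (rule sum.cong) (auto simp: err_def)
qed

lemma bucket_spec:
  fixes \<sigma> :: "'a::ring_1 mem" and f :: bool
  assumes regs: "regs \<sigma>" and mats: "mats \<sigma> A B C" and q: "fst \<sigma> rQ < M"
  defines "\<sigma>' \<equiv> sem (bucket f) \<sigma>"
  shows "\<And>a. 4 \<le> a \<Longrightarrow> a < bY \<Longrightarrow> snd \<sigma>' a = snd \<sigma> a"
    and "\<And>i j q. i < n \<Longrightarrow> j < n \<Longrightarrow> q < M \<Longrightarrow> snd \<sigma>' (vaddr i j q) =
      (if j mod fst \<sigma> rP = fst \<sigma> rR \<and> q = fst \<sigma> rQ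
       then \<Sum>j'<n. if j' mod fst \<sigma> rP = fst \<sigma> rR then err f A B C i j' else 0
       else snd \<sigma> (vaddr i j q))"
proof -
  let ?p = "fst \<sigma> rP" and ?r = "fst \<sigma> rR" and ?q = "fst \<sigma> rQ"
  let ?Y = "For rL rN (bucket_sum rB rL ;; Do [NOp NAdd rD rL rY, RStore rD 0])"
  define \<tau> where "\<tau> = sem ?Y \<sigma>"
  define y where "y l = (\<Sum>j<n. if j mod ?p = ?r then B l j else 0)" for l
  define w where "w i = (\<Sum>j<n. if j mod ?p = ?r then err f A B C i j else 0)" for i
  \<comment> \<open>Only the buffer between \<open>bY\<close> and \<open>bV\<close> changes, so the
    matrices and the votes collected so far survive.\<close>
  have Y: "(\<forall>l<n. snd \<tau> (l + bY) = y l) \<and> (\<forall>a. 4 \<le> a \<longrightarrow> a < bY \<or> bV \<le> a \<longrightarrow> snd \<tau> a = snd \<sigma> a)"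
    unfolding \<tau>_def
  proof (rule For_rule[where I = "\<lambda>m \<tau>. (\<forall>l<m. snd \<tau> (l + bY) = y l) \<and>
      (\<forall>a. 4 \<le> a \<longrightarrow> a < bY \<or> bV \<le> a \<longrightarrow> snd \<tau> a = snd \<sigma> a)"], goal_cases)
    case 1
    show ?case by auto
  next
    case 2
    show ?case by auto
  next
    case (3 m \<tau>)
    have m: "m < n" using 3 regs by (simp add: regs_def)
    let ?t = "set_reg rL m \<tau>"
    have fr: "fst ?t rB = bB" "fst ?t rN = n" "fst ?t rP = ?p" "fst ?t rR = ?r" "fst ?t rRS = RS"
      "fst ?t rCS = CS" "fst ?t rL = m" "fst ?t rY = bY" using 3(3) regs by (simp_all add: regs_def)
    have B: "snd \<tau> (m * RS + j * CS + bB) = B m j" if "j < n" for j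
    proof -
      have "mats \<tau> A B C" using 3(2) by (intro mats_cong[OF mats]) auto
      then show ?thesis using that m by (auto simp: mats_def off_def)
    qed
    have "4 \<le> fst ?t rB" using fr bases by simp
    note spec = bucket_sum_spec[of rB rL ?t, OF _ _ this]
    have "snd (sem (bucket_sum rB rL) ?t) 0 = y m"
      using B by (subst spec(1)) (auto simp: fr[simplified] y_def intro!: sum.cong)
    moreover have "snd (sem (bucket_sum rB rL) ?t) a = snd \<tau> a" if "4 \<le> a" for a
      using that by (subst spec(2)) auto
    ultimately show ?case
      using 3(2) fr m bases by (auto simp: less_Suc_eq)
  next
    case (4 \<tau>)
    then show ?case using regs by (auto simp: regs_def)
  qed
  have fr\<tau>: "fst \<tau> x = fst \<sigma> x" if "x \<notin> {rL, rJ, rT, rD}" for x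
    unfolding \<tau>_def using that by (subst fst_sem) auto
  have mats\<tau>: "mats \<tau> A B C" using Y by (intro mats_cong[OF mats]) auto
  have main: "(\<forall>a. 4 \<le> a \<longrightarrow> a < bV \<longrightarrow> snd \<sigma>' a = snd \<tau> a) \<and>
      (\<forall>i j q. i < n \<longrightarrow> j < n \<longrightarrow> q < M \<longrightarrow> snd \<sigma>' (vaddr i j q) =
        (if i < n \<and> j mod ?p = ?r \<and> q = ?q then w i else snd \<tau> (vaddr i j q)))"
    unfolding \<sigma>'_def bucket_def sem.simps(2) \<tau>_def[symmetric]
  proof (rule For_rule[where I = "\<lambda>m \<rho>. (\<forall>a. 4 \<le> a \<longrightarrow> a < bV \<longrightarrow> snd \<rho> a = snd \<tau> a) \<and>
      (\<forall>i j q. i < n \<longrightarrow> j < n \<longrightarrow> q < M \<longrightarrow> snd \<rho> (vaddr i j q) =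
        (if i < m \<and> j mod ?p = ?r \<and> q = ?q then w i else snd \<tau> (vaddr i j q)))"], goal_cases)
    case 1
    show ?case by auto
  next
    case 2
    show ?case by auto
  next
    case (3 m \<rho>)
    have m: "m < n" using 3 regs fr\<tau> by (simp add: regs_def)
    let ?t = "set_reg rI m \<rho>"
    define s1 where "s1 = sem (bucket_sum rC rI) ?t"
    define s2 where "s2 = sem (dot f) s1"
    have fr: "fst ?t rC = bC" "fst ?t rA = bA" "fst ?t rN = n" "fst ?t rP = ?p" "fst ?t rR = ?r"
      "fst ?t rRS = RS" "fst ?t rCS = CS" "fst ?t rI = m" "fst ?t rY = bY" "fst ?t rV = bV"
      "fst ?t rM = M" "fst ?t rQ = ?q"
      using 3(3) regs by (simp_all add: regs_def fr\<tau>)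
    have fr1: "fst s1 x = fst ?t x" if "x \<notin> {rJ, rT, rD}" for x
      unfolding s1_def using that by (subst fst_sem) auto
    have fr2: "fst s2 x = fst s1 x" if "x \<notin> {rL, rT, rD}" for x
      unfolding s2_def using that by (subst fst_sem) auto
    have "mats \<rho> A B C" using 3(2) bases by (intro mats_cong[OF mats\<tau>]) auto
    then have AC: "snd \<rho> (m * RS + j * CS + bC) = C m j" "snd \<rho> (m * RS + j * CS + bA) = A m j"
      if "j < n" for j using that m by (auto simp: mats_def off_def)
    have yl: "snd \<rho> (l + bY) = y l" if "l < n" for l
    proof -
      have "4 \<le> l + bY" "l + bY < bV" using that bases by auto
      then show ?thesis using 3(2) Y that by auto
    qed
    have c1: "4 \<le> fst ?t rC" "4 \<le> fst s1 rA" "4 \<le> fst s1 rY" "4 \<le> fst s2 rV"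
      using bases fr by (simp_all add: fr1 fr2)
    have s1: "snd s1 0 = (\<Sum>j<n. if j mod ?p = ?r then C m j else 0)"
      unfolding s1_def using AC
      by (subst bucket_sum_spec(1)[OF _ _ c1(1)]) (auto simp: fr[simplified] intro!: sum.cong)
    have s1': "snd s1 a = snd \<rho> a" if "4 \<le> a" for a
      unfolding s1_def using that by (subst bucket_sum_spec(2)[OF _ _ c1(1)]) auto
    have "snd s2 0 = snd s1 0 - (\<Sum>l<n. mul f (A m l) (y l))"
      unfolding s2_def using AC yl c1 bases
      by (subst dot_spec(1)) (auto simp: fr1 fr[simplified] s1' intro!: sum.cong)
    then have s2: "snd s2 0 = w m"
      using err_bucket[of ?p ?r C m f A B] by (simp add: s1 w_def y_def)
    have s2': "snd s2 a = snd \<rho> a" if "4 \<le> a" for a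
      unfolding s2_def using that c1 by (subst dot_spec(2)) (auto simp: s1')
    have s3: "snd (sem bucket_store s2) = (\<lambda>a. if \<exists>j<n. j mod ?p = ?r \<and> a = vaddr m j ?q then w m else snd s2 a)"
      unfolding bucket_store_spec[OF c1(4)] s2 by (simp add: fr1 fr2 fr[simplified] vaddr_def)
    have "sem (bucket_sum rC rI ;; dot f ;; bucket_store) ?t = sem bucket_store s2"
      by (simp add: s2_def s1_def)
    moreover have "snd (sem bucket_store s2) a = snd \<tau> a" if "4 \<le> a" "a < bV" for a
    proof -
      have "a \<noteq> vaddr m j ?q" for j using that bV_le_vaddr[of m j ?q] by auto
      then show ?thesis using 3(2) that by (auto simp: s3 s2')
    qed
    moreover have "snd (sem bucket_store s2) (vaddr i j q') =
        (if i < Suc m \<and> j mod ?p = ?r \<and> q' = ?q then w i else snd \<tau> (vaddr i j q'))"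
      if "i < n" "j < n" "q' < M" for i j q'
    proof -
      have "4 \<le> vaddr i j q'" using bV_le_vaddr[of i j q'] bases by linarith
      \<comment> \<open>Injectivity of the slot addresses: storing for row \<open>m\<close> hits no
        slot of another row, column class or prime.\<close>
      moreover have "(\<exists>j'<n. j' mod ?p = ?r \<and> vaddr i j q' = vaddr m j' ?q) \<longleftrightarrow>
          i = m \<and> j mod ?p = ?r \<and> q' = ?q"
        using vaddr_inject that q by auto
      ultimately show ?thesis using 3(2) that by (auto simp: s3 s2' less_Suc_eq)
    qed
    ultimately show ?case by simp
  next
    case (4 \<rho>)
    then show ?case using regs fr\<tau> by (auto simp: regs_def)
  qed
  show "snd \<sigma>' a = snd \<sigma> a" if "4 \<le> a" "a < bY" for a
    using main Y that bases by auto
  fix i j q assume ijq: "i < n" "j < n" "q < M"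
  have "4 \<le> vaddr i j q" "bV \<le> vaddr i j q" using bV_le_vaddr[of i j q] bases by linarith+
  then have "snd \<tau> (vaddr i j q) = snd \<sigma> (vaddr i j q)" using Y by blast
  then show "snd \<sigma>' (vaddr i j q) = (if j mod ?p = ?r \<and> q = ?q
       then \<Sum>j'<n. if j' mod ?p = ?r then err f A B C i j' else 0 else snd \<sigma> (vaddr i j q))"
    using main ijq by (simp add: w_def)
qed

definition vote :: "bool \<Rightarrow> (nat \<Rightarrow> nat \<Rightarrow> 'a::ring_1) \<Rightarrow> (nat \<Rightarrow> nat \<Rightarrow> 'a) \<Rightarrow> (nat \<Rightarrow> nat \<Rightarrow> 'a) \<Rightarrow> nat \<Rightarrow> nat \<Rightarrow> nat \<Rightarrow> 'a" where
  "vote f A B C i j p = (\<Sum>j'<n. if j' mod p = j mod p then err f A B C i j' else 0)"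

text \<open>Round \<open>r\<close> fills the slots of the columns congruent to \<open>r\<close>. As
  \<open>p\<close> is positive, every residue is below \<open>p\<close>, so after \<open>p\<close>
  rounds each column has received its vote.\<close>

lemma buckets_spec:
  fixes \<sigma> :: "'a::ring_1 mem" and f :: bool
  assumes regs: "regs \<sigma>" and mats: "mats \<sigma> A B C" and q: "fst \<sigma> rQ < M" and p: "fst \<sigma> rP > 0"
  defines "\<sigma>' \<equiv> sem (For rR rP (bucket f)) \<sigma>"
  shows "\<And>a. 4 \<le> a \<Longrightarrow> a < bY \<Longrightarrow> snd \<sigma>' a = snd \<sigma> a"
    and "\<And>i j q. i < n \<Longrightarrow> j < n \<Longrightarrow> q < M \<Longrightarrow> snd \<sigma>' (vaddr i j q) =
      (if q = fst \<sigma> rQ then vote f A B C i j (fst \<sigma> rP) else snd \<sigma> (vaddr i j q))"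
proof -
  let ?p = "fst \<sigma> rP" and ?q = "fst \<sigma> rQ"
  have "(\<forall>a. 4 \<le> a \<longrightarrow> a < bY \<longrightarrow> snd \<sigma>' a = snd \<sigma> a) \<and>
      (\<forall>i j q. i < n \<longrightarrow> j < n \<longrightarrow> q < M \<longrightarrow> snd \<sigma>' (vaddr i j q) =
        (if j mod ?p < ?p \<and> q = ?q then vote f A B C i j ?p else snd \<sigma> (vaddr i j q)))"
    unfolding \<sigma>'_def
  proof (rule For_rule[where I = "\<lambda>m \<rho>. (\<forall>a. 4 \<le> a \<longrightarrow> a < bY \<longrightarrow> snd \<rho> a = snd \<sigma> a) \<and>
      (\<forall>i j q. i < n \<longrightarrow> j < n \<longrightarrow> q < M \<longrightarrow> snd \<rho> (vaddr i j q) =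
        (if j mod ?p < m \<and> q = ?q then vote f A B C i j ?p else snd \<sigma> (vaddr i j q)))"], goal_cases)
    case 1
    show ?case by auto
  next
    case 2
    show ?case by auto
  next
    case (3 m \<rho>)
    let ?t = "set_reg rR m \<rho>"
    have "regs ?t" using 3(3) regs by (simp add: regs_def)
    moreover have "mats ?t A B C" using 3(2) by (intro mats_cong[OF mats]) auto
    moreover have fr: "fst ?t rP = ?p" "fst ?t rR = m" "fst ?t rQ = ?q" using 3(3) by simp_all
    ultimately have spec: "\<And>a. 4 \<le> a \<Longrightarrow> a < bY \<Longrightarrow> snd (sem (bucket f) ?t) a = snd ?t a"
      "\<And>i j q. i < n \<Longrightarrow> j < n \<Longrightarrow> q < M \<Longrightarrow> snd (sem (bucket f) ?t) (vaddr i j q) =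
      (if j mod ?p = m \<and> q = ?q
       then \<Sum>j'<n. if j' mod ?p = m then err f A B C i j' else 0
       else snd ?t (vaddr i j q))"
      using bucket_spec[of ?t A B C] q by simp_all
    show ?case using 3(2) by (auto simp: spec vote_def less_Suc_eq)
  next
    case (4 \<rho>)
    then show ?case by auto
  qed
  then show "\<And>a. 4 \<le> a \<Longrightarrow> a < bY \<Longrightarrow> snd \<sigma>' a = snd \<sigma> a"
    "\<And>i j q. i < n \<Longrightarrow> j < n \<Longrightarrow> q < M \<Longrightarrow> snd \<sigma>' (vaddr i j q) =
      (if q = fst \<sigma> rQ then vote f A B C i j (fst \<sigma> rP) else snd \<sigma> (vaddr i j q))"
    using p by simp_all
qed

lemma collect_votes_spec:
  fixes \<sigma> :: "'a::ring_1 mem" and f :: bool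
  assumes regs: "regs \<sigma>" and mats: "mats \<sigma> A B C"
  defines "\<sigma>' \<equiv> sem (collect_votes f) \<sigma>"
  shows "\<And>a. 4 \<le> a \<Longrightarrow> a < bY \<Longrightarrow> snd \<sigma>' a = snd \<sigma> a"
    and "fst \<sigma>' rQ = length (primes_below M)"
    and "\<And>i j q. i < n \<Longrightarrow> j < n \<Longrightarrow> q < length (primes_below M) \<Longrightarrow>
      snd \<sigma>' (vaddr i j q) = vote f A B C i j (primes_below M ! q)"
proof -
  let ?I = "\<lambda>m \<rho>. (\<forall>a. 4 \<le> a \<longrightarrow> a < bY \<longrightarrow> snd \<rho> a = snd \<sigma> a) \<and>
      fst \<rho> rQ = length (primes_below m) \<and>
      (\<forall>i j q. i < n \<longrightarrow> j < n \<longrightarrow> q < length (primes_below m) \<longrightarrow>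
        snd \<rho> (vaddr i j q) = vote f A B C i j (primes_below m ! q))"
  have "?I M \<sigma>'"
    unfolding \<sigma>'_def collect_votes_def sem.simps(2)[of "Do [NConst rQ 0]"]
  proof (rule For_rule[where I = ?I], goal_cases)
    case 1
    show ?case by auto
  next
    case 2
    show ?case by (simp add: primes_below_def)
  next
    case (3 m \<rho>)
    have m: "m < M" using 3 regs by (simp add: regs_def)
    define t where "t = sem prime_test (set_reg rP m \<rho>)"
    have fr: "fst t x = fst (set_reg rP m \<rho>) x" if "x \<notin> {rF, rT, rX}" for x
      unfolding t_def using that by (subst fst_sem) auto
    have regst: "regs t" using 3(3) regs by (simp add: regs_def fr)
    have fr': "fst t rP = m" "fst t rQ = length (primes_below m)" "fst t one_reg = 1"
      using 3(2) regst by (simp_all add: fr regs_def)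
    have "fst (set_reg rP m \<rho>) one_reg = 1" "fst (set_reg rP m \<rho>) rZ = 0"
      using regs 3(3) by (simp_all add: regs_def)
    from prime_test_spec[OF this] have t: "snd t = snd \<rho>" "fst t rF = (if prime m then 1 else 0)"
      by (simp_all add: t_def)
    show ?case
    proof (cases "prime m")
      case False
      have "sem (prime_test ;; Cond (EqN rF one_reg) (For rR rP (bucket f) ;; Do [NOp NAdd rQ rQ one_reg]) Skip)
          (set_reg rP m \<rho>) = t"
        using False t fr' by (simp add: t_def[symmetric])
      then show ?thesis using 3(2) False by (auto simp: t fr' primes_below_Suc)
    next
      case True
      have "sem (prime_test ;; Cond (EqN rF one_reg) (For rR rP (bucket f) ;; Do [NOp NAdd rQ rQ one_reg]) Skip)
          (set_reg rP m \<rho>) = sem (Do [NOp NAdd rQ rQ one_reg]) (sem (For rR rP (bucket f)) t)"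
        using True t fr' by (simp add: t_def[symmetric])
      moreover have "mats t A B C" using 3(2) by (intro mats_cong[OF mats]) (auto simp: t)
      \<comment> \<open>Fewer than \<open>M\<close> primes have been found so far, so the next slot
        stays within the \<open>M\<close> slots of its entry.\<close>
      moreover have lm: "length (primes_below m) < M" using length_primes_below[of m] m by linarith
      moreover have "m > 0" using True by (simp add: prime_gt_0_nat)
      ultimately show ?thesis
        using 3(2) regst True buckets_spec[where \<sigma> = t and f = f and A = A and B = B and C = C] fst_sem[of "For rR rP (bucket f)" _ t]
        by (auto simp: fr' t primes_below_Suc nth_append less_Suc_eq)
    qed
  next
    case (4 \<tau>)
    then show ?case using regs by (auto simp: regs_def)
  qed
  then show "\<And>a. 4 \<le> a \<Longrightarrow> a < bY \<Longrightarrow> snd \<sigma>' a = snd \<sigma> a"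
    "fst \<sigma>' rQ = length (primes_below M)"
    "\<And>i j q. i < n \<Longrightarrow> j < n \<Longrightarrow> q < length (primes_below M) \<Longrightarrow>
      snd \<sigma>' (vaddr i j q) = vote f A B C i j (primes_below M ! q)"
    by simp_all
qed

lemma apply_votes_spec:
  fixes \<sigma> :: "'a::ring_1 mem"
  assumes regs: "regs \<sigma>" and mats: "mats \<sigma> A B C" and q: "fst \<sigma> rQ \<le> M"
  shows "mats (sem apply_votes \<sigma>) A B (\<lambda>i j. C i j -
    fst (fold majority_step (map (\<lambda>q. snd \<sigma> (vaddr i j q)) [0..<fst \<sigma> rQ]) (0, 0)))"
proof -
  define D where "D i j = C i j -
    fst (fold majority_step (map (\<lambda>q. snd \<sigma> (vaddr i j q)) [0..<fst \<sigma> rQ]) (0, 0))" for i j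
  \<comment> \<open>\<open>R\<close> is the region already corrected, which lets the nested loops
    share one invariant.\<close>
  let ?I = "\<lambda>R \<rho>. (\<forall>a. 4 \<le> a \<longrightarrow> a < bC \<or> bY \<le> a \<longrightarrow> snd \<rho> a = snd \<sigma> a) \<and>
      (\<forall>i j. i < n \<longrightarrow> j < n \<longrightarrow> snd \<rho> (off i j + bC) = (if R i j then D i j else C i j))"
  let ?body = "majority ;; Do (entry_address rC rI rJ @ [RLoad 1 rD, RSub 1 1 0, RStore rD 1])"
  have "?I (\<lambda>i j. i < n) (sem apply_votes \<sigma>)"
    unfolding apply_votes_def
  proof (rule For_rule[where I = "\<lambda>m \<rho>. ?I (\<lambda>i j. i < m) \<rho>"], goal_cases)
    case 1
    show ?case by auto
  next
    case 2
    show ?case using mats by (auto simp: mats_def)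
  next
    case (3 m \<rho>)
    have m: "m < n" using 3 regs by (simp add: regs_def)
    have rN: "fst (set_reg rI m \<rho>) rN = n" using 3(3) regs by (simp add: regs_def)
    show ?case
    proof (rule For_rule[where I = "\<lambda>m' \<rho>'. ?I (\<lambda>i j. i < m \<or> i = m \<and> j < m') \<rho>'"], goal_cases)
      case 1
      show ?case by auto
    next
      case 2
      show ?case using 3(2) by auto
    next
      case inner: (3 m' \<rho>')
      have m': "m' < n" using inner(1) rN by simp
      let ?t = "set_reg rJ m' \<rho>'"
      define t where "t = sem majority ?t"
      have regs': "regs ?t" using inner(3) 3(3) regs by (simp add: regs_def)
      have fr0: "fst ?t rI = m" "fst ?t rJ = m'" "fst ?t rQ = fst \<sigma> rQ"
        using inner(3) 3(3) by simp_all
      have fr: "fst t x = fst ?t x" if "x \<notin> {rW, rX, rD}" for x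
        unfolding t_def using that by (subst fst_sem) auto
      \<comment> \<open>The votes lie beyond the matrices, so corrections made earlier do not
        influence later majorities.\<close>
      have val: "snd \<rho>' (vaddr i j q) = snd \<sigma> (vaddr i j q)" for i j q
        using inner(2) bV_le_vaddr[of i j q] bases by auto
      have c: "fst ?t one_reg = 1" "fst ?t rZ = 0" "4 \<le> fst ?t rV" "fst ?t rQ \<le> fst ?t rM"
        using regs' fr0 q bases by (auto simp: regs_def)
      have rr: "fst ?t rN = n" "fst ?t rM = M" "fst ?t rV = bV" "fst ?t rRS = RS" "fst ?t rCS = CS"
        "fst ?t rC = bC" using regs' by (auto simp: regs_def)
      have t0: "C m m' - snd t 0 = D m m'"
        unfolding t_def majority_spec(1)[OF c] D_def rr fr0 set_reg_simps(2)
        by (simp add: val[unfolded vaddr_def] vaddr_def)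
      have ta: "snd t a = snd \<rho>' a" if "4 \<le> a" for a
        unfolding t_def using majority_spec(2)[OF c that] by simp
      have mC: "snd \<rho>' (off m m' + bC) = C m m'" using inner(2) m m' by auto
      have "4 \<le> bC" using bases by linarith
      then have eq: "snd (sem ?body ?t) = (snd t)(1 := D m m', off m m' + bC := D m m')"
        using mC t0 fr rr fr0 ta[of "off m m' + bC"]
        by (auto simp: t_def[symmetric] off_def fun_eq_iff)
      have "snd (sem ?body ?t) a = snd \<sigma> a" if "4 \<le> a" "a < bC \<or> bY \<le> a" for a
        using inner(2) that off_less[OF m m'] bases unfolding eq by (auto simp: ta)
      moreover have "snd (sem ?body ?t) (off i j + bC) = (if i < m \<or> i = m \<and> j < Suc m' then D i j else C i j)"
        if "i < n" "j < n" for i j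
        using inner(2) that off_inject[OF that m m'] \<open>4 \<le> bC\<close> unfolding eq by (auto simp: ta less_Suc_eq)
      ultimately show ?case by blast
    next
      case (4 \<tau>)
      then show ?case using rN by (auto simp: less_Suc_eq)
    qed
  next
    case (4 \<tau>)
    then show ?case using regs by (auto simp: regs_def)
  qed
  moreover have "4 \<le> off i j + bA" "off i j + bA < bC" "4 \<le> off i j + bB" "off i j + bB < bC"
    if "i < n" "j < n" for i j
    using off_less[OF that] bases by linarith+
  ultimately show ?thesis using mats by (auto simp: mats_def D_def)
qed

text \<open>Nothing is claimed about rows with more than \<open>s\<close> errors: their votes may be
  wrong, and their entries in the new matrix are arbitrary.\<close>

lemma phase_spec:
  fixes \<sigma> :: "'a::ring_1 mem"
  assumes regs: "regs \<sigma>" and mats: "mats \<sigma> A B C"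
    and n: "n \<le> 2 ^ l" and M: "2 * (s * l) < length (primes_below M)"
  obtains C' where "mats (sem (phase f) \<sigma>) A B C'"
    and "\<And>i j. i < n \<Longrightarrow> j < n \<Longrightarrow> card {j. j < n \<and> err f A B C i j \<noteq> 0} \<le> s \<Longrightarrow> err f A B C' i j = 0"
proof -
  define t where "t = sem (collect_votes f) \<sigma>"
  note votes = collect_votes_spec[OF regs mats, where f = f, folded t_def]
  define C' where "C' = (\<lambda>i j. C i j -
    fst (fold majority_step (map (\<lambda>q. snd t (vaddr i j q)) [0..<fst t rQ]) (0, 0)))"
  have "regs t" using regs by (simp add: regs_def t_def)
  moreover have "mats t A B C" using votes(1) by (rule mats_cong[OF mats])
  moreover have "fst t rQ \<le> M" using votes(2) length_primes_below by simp
  ultimately have "mats (sem apply_votes t) A B C'"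
    unfolding C'_def by (rule apply_votes_spec)
  then have "mats (sem (phase f) \<sigma>) A B C'" by (simp only: phase_def sem.simps t_def)
  moreover have "err f A B C' i j = 0"
    if ij: "i < n" "j < n" and light: "card {j. j < n \<and> err f A B C i j \<noteq> 0} \<le> s" for i j
  proof -
    let ?e = "err f A B C i"
    have "map (\<lambda>q. snd t (vaddr i j q)) [0..<fst t rQ] = map (vote f A B C i j) (primes_below M)"
      using votes(2,3) ij by (intro nth_equalityI) auto
    also have "\<dots> = map (\<lambda>p. \<Sum>j' | j' < n \<and> j' mod p = j mod p. ?e j') (primes_below M)"
    proof -
      have "vote f A B C i j p = (\<Sum>j' | j' < n \<and> j' mod p = j mod p. ?e j')" for p
        using sum.inter_filter[of "{..<n}" ?e "\<lambda>j'. j' mod p = j mod p"] by (simp add: vote_def)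
      then show ?thesis by simp
    qed
    finally have votes_eq: "map (\<lambda>q. snd t (vaddr i j q)) [0..<fst t rQ]
      = map (\<lambda>p. \<Sum>j' | j' < n \<and> j' mod p = j mod p. ?e j') (primes_below M)" .
    have "length (primes_below M)
        < 2 * count_list (map (\<lambda>p. \<Sum>j' | j' < n \<and> j' mod p = j mod p. ?e j') (primes_below M)) (?e j)"
      by (rule bucket_majority[OF light n ij(2) M]) (simp_all add: primes_below_def)
    then have "fst (fold majority_step (map (\<lambda>q. snd t (vaddr i j q)) [0..<fst t rQ]) (0, 0)) = ?e j"
      unfolding votes_eq by (intro majority_correct) simp_all
    \<comment> \<open>Lowering an entry by the vote lowers its error by the same amount.\<close>
    then show ?thesis by (simp add: C'_def err_def)
  qed
  ultimately show thesis using that by blast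
qed

end

section \<open>The complete algorithm\<close>

abbreviation (input) rK :: nat where "rK \<equiv> 1"
abbreviation (input) rN2 :: nat where "rN2 \<equiv> 23"
abbreviation (input) rG :: nat where "rG \<equiv> 24"
abbreviation (input) rNK :: nat where "rNK \<equiv> 25"
abbreviation (input) rK1 :: nat where "rK1 \<equiv> 26"
abbreviation (input) rPow :: nat where "rPow \<equiv> 27"
abbreviation (input) rLog :: nat where "rLog \<equiv> 28"
abbreviation (input) rS :: nat where "rS \<equiv> 29"

text \<open>The ring cells 0 to 3 contain input entries, so they are saved before they serve as scratch.\<close>

definition init_regs :: com where
  "init_regs = Do
    [NOp NMul rN2 rN rN, NOp NAdd rG rN2 rN2, NOp NAdd rG rG rN2, NConst rT 4,
     NOp NAdd rA rG rT, NOp NSub rG rG rT,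
     NOp NAdd rB rA rN2, NOp NAdd rC rB rN2, NOp NAdd rY rC rN2, NOp NAdd rV rY rN,
     NOp NAdd rRS rN rZ, NConst rCS 1,
     NOp NAdd rK1 rK one_reg, NOp NAdd rNK rN rK1, NOp NAdd rNK rNK one_reg,
     NConst rPow 1, NConst rLog 0, NConst rS 0,
     RStore rA 0, NOp NAdd rD rA one_reg, RStore rD 1, NOp NAdd rD rD one_reg, RStore rD 2,
     NOp NAdd rD rD one_reg, RStore rD 3]"

text \<open>The copy starts at cell 4, because \<open>init_regs\<close> has already put the first
  four cells in place; \<open>rT\<close> still holds 4. The target begins beyond the input, so no
  source cell is overwritten.\<close>

definition relocate :: com where
  "relocate = For rX rG (Do [NOp NAdd rD rX rT, RLoad 0 rD, NOp NAdd rD rD rA, RStore rD 0])"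

text \<open>The language has no while loop, so the search runs for a sufficient number of rounds and
  idles once the goal is reached. The linear number of rounds fits the time bound.\<close>

definition compute_log :: com where
  "compute_log = For rX rNK (Cond (Lt rPow rNK)
    (Do [NOp NAdd rPow rPow rPow, NOp NAdd rLog rLog one_reg]) Skip)"

definition compute_sqrt :: com where
  "compute_sqrt = For rX rK1 (Do [NOp NMul rT rS rS] ;;
    Cond (Lt rT rK1) (Do [NOp NAdd rS rS one_reg]) Skip)"

definition compute_modulus_bound :: com where
  "compute_modulus_bound = Do
    [NConst rT 8, NOp NMul rM rT rS, NOp NMul rM rM rLog, NOp NMul rM rM rLog, NConst rT 2,
     NOp NAdd rM rM rT]"

text \<open>The transpose of A B has the transpose of B as its left factor. Exchanging strides and
  base addresses realises this without moving data; adding \<open>rZ\<close> copies a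
  register.\<close>

definition transpose_layout :: com where
  "transpose_layout = Do
    [NConst rRS 1, NOp NAdd rCS rN rZ, NOp NAdd rD rA rZ, NOp NAdd rA rB rZ, NOp NAdd rB rD rZ]"

text \<open>Copying downwards makes the scratch cell 0 the last cell to be overwritten.\<close>

definition write_output :: com where
  "write_output = For rX rN2 (Do [NOp NSub rD rN2 one_reg, NOp NSub rD rD rX,
    NOp NAdd rT rC rD, RLoad 0 rT, RStore rD 0])"

definition preamble :: com where
  "preamble = init_regs ;; relocate ;; compute_log ;; compute_sqrt ;; compute_modulus_bound"

definition correction :: com where
  "correction = preamble ;; phase True ;; transpose_layout ;; phase False ;; write_output"

definition correction_program :: "instr list" where
  "correction_program = NConst one_reg 1 # compile 1 correction"

lemmas preamble_defs = init_regs_def relocate_def compute_log_def compute_sqrt_def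
  compute_modulus_bound_def

lemma wf_parts [simp]: "wf_com init_regs" "wf_com relocate" "wf_com compute_log"
    "wf_com compute_sqrt" "wf_com compute_modulus_bound" "wf_com transpose_layout" "wf_com write_output"
  and writes_parts [simp]:
    "writes init_regs = {rN2, rG, rT, rA, rB, rC, rY, rV, rRS, rCS, rK1, rNK, rPow, rLog, rS, rD}"
    "writes relocate = {rX, rD}" "writes compute_log = {rX, rPow, rLog}"
    "writes compute_sqrt = {rX, rT, rS}" "writes compute_modulus_bound = {rT, rM}"
    "writes transpose_layout = {rRS, rCS, rD, rA, rB}" "writes write_output = {rX, rD, rT}"
  by (auto simp: preamble_defs transpose_layout_def write_output_def)

lemma wf_correction: "wf_com correction" "one_reg \<notin> writes correction"
  by (auto simp: correction_def preamble_def)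

section \<open>Effect of the preamble and of the output loop\<close>

lemma init_regs_spec:
  fixes \<sigma> :: "'a::ring_1 mem"
  assumes "fst \<sigma> rN = n" "fst \<sigma> rK = k" "fst \<sigma> rZ = 0" "fst \<sigma> one_reg = 1"
  defines "\<tau> \<equiv> sem init_regs \<sigma>" and "T \<equiv> 3 * (n * n) + 4"
  shows "fst \<tau> rN2 = n * n" "fst \<tau> rA = T" "fst \<tau> rB = T + n * n" "fst \<tau> rC = T + 2 * (n * n)"
    "fst \<tau> rY = T + 3 * (n * n)" "fst \<tau> rV = T + 3 * (n * n) + n" "fst \<tau> rRS = n" "fst \<tau> rCS = 1"
    "fst \<tau> rG = 3 * (n * n) - 4" "fst \<tau> rT = 4" "fst \<tau> rNK = n + k + 2" "fst \<tau> rK1 = k + 1"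
    "fst \<tau> rPow = 1" "fst \<tau> rLog = 0" "fst \<tau> rS = 0"
    "\<forall>x<4. snd \<tau> (x + T) = snd \<sigma> x" "\<forall>a<T. snd \<tau> a = snd \<sigma> a"
proof -
  show "\<forall>x<4. snd \<tau> (x + T) = snd \<sigma> x"
  proof (intro allI impI)
    fix x :: nat assume "x < 4"
    then consider "x = 0" | "x = 1" | "x = 2" | "x = 3" by linarith
    then show "snd \<tau> (x + T) = snd \<sigma> x"
      by cases (use assms(1-4) in \<open>simp_all add: \<tau>_def T_def init_regs_def\<close>)
  qed
qed (use assms(1-4) in \<open>simp_all add: \<tau>_def T_def init_regs_def\<close>)

lemma relocate_spec:
  fixes \<sigma> :: "'a::ring_1 mem"
  assumes "fst \<sigma> rG = N - 4" "fst \<sigma> rT = 4" "fst \<sigma> rA = N + 4"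
    and "\<forall>x<4. snd \<sigma> (x + (N + 4)) = m x" "\<forall>a<N. 4 \<le> a \<longrightarrow> snd \<sigma> a = m a"
  shows "\<forall>x<N. snd (sem relocate \<sigma>) (x + (N + 4)) = m x"
  unfolding relocate_def
\<comment> \<open>The offset 4 stands for the cells saved before the loop. For \<open>N < 4\<close>
  there are no rounds and those cells already cover everything.\<close>
proof (rule For_rule[where I = "\<lambda>i \<tau>. (\<forall>x<i + 4. snd \<tau> (x + (N + 4)) = m x) \<and>
    (\<forall>a<N. 4 \<le> a \<longrightarrow> snd \<tau> a = m a)"], goal_cases)
  case 1
  show ?case by auto
next
  case 2
  show ?case using assms by auto
next
  case (3 i \<tau>)
  then have i: "i + 4 < N" using assms by auto
  have fr: "fst \<tau> 18 = 4" "fst \<tau> 5 = N + 4" using 3(3) assms by auto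
  have "snd \<tau> (i + 4) = m (i + 4)" using 3(2) i by auto
  then show ?case using 3(2) i by (auto simp: fr less_Suc_eq add.commute)
next
  case (4 \<tau>)
  then show ?case using assms by auto
qed

text \<open>Until the goal is reached each round doubles, so \<open>N\<close> rounds suffice because
  \<open>N < 2 ^ N\<close>. Minimality of the logarithm is what the time bound needs.\<close>

lemma compute_log_spec:
  fixes \<sigma> :: "'a::ring_1 mem"
  assumes "fst \<sigma> rPow = 1" "fst \<sigma> rLog = 0" "fst \<sigma> one_reg = 1" "fst \<sigma> rNK = N"
  defines "l \<equiv> fst (sem compute_log \<sigma>) rLog"
  shows "N \<le> 2 ^ l" "l = 0 \<or> 2 ^ (l - 1) < N" "snd (sem compute_log \<sigma>) = snd \<sigma>"
proof -
  let ?I = "\<lambda>i \<tau>. snd \<tau> = snd \<sigma> \<and> fst \<tau> rPow = 2 ^ fst \<tau> rLog \<and> (fst \<tau> rLog = i \<or> N \<le> fst \<tau> rPow) \<and>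
    (fst \<tau> rLog = 0 \<or> 2 ^ (fst \<tau> rLog - 1) < N)"
  have "?I N (sem compute_log \<sigma>)"
    unfolding compute_log_def
  proof (rule For_rule[where I = ?I], goal_cases)
    case (3 i \<tau>)
    then show ?case using assms by auto
  qed (use assms in auto)
  moreover have "N < 2 ^ N" by (rule less_exp)
  ultimately show "N \<le> 2 ^ l" "l = 0 \<or> 2 ^ (l - 1) < N" "snd (sem compute_log \<sigma>) = snd \<sigma>"
    by (auto simp: l_def)
qed

lemma compute_sqrt_spec:
  fixes \<sigma> :: "'a::ring_1 mem"
  assumes "fst \<sigma> rS = 0" "fst \<sigma> one_reg = 1" "fst \<sigma> rK1 = k + 1"
  defines "s \<equiv> fst (sem compute_sqrt \<sigma>) rS"
  shows "k < s * s" "(s - 1) * (s - 1) \<le> k" "snd (sem compute_sqrt \<sigma>) = snd \<sigma>"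
proof -
  let ?I = "\<lambda>i \<tau>. snd \<tau> = snd \<sigma> \<and> (fst \<tau> rS = i \<or> k < fst \<tau> rS * fst \<tau> rS) \<and>
    (fst \<tau> rS - 1) * (fst \<tau> rS - 1) \<le> k"
  have "?I (k + 1) (sem compute_sqrt \<sigma>)"
    unfolding compute_sqrt_def
  proof (rule For_rule[where I = ?I], goal_cases)
    case (3 i \<tau>)
    then show ?case using assms by auto
  qed (use assms in auto)
  moreover have "k < (k + 1) * (k + 1)" by simp
  ultimately show "k < s * s" "(s - 1) * (s - 1) \<le> k" "snd (sem compute_sqrt \<sigma>) = snd \<sigma>"
    by (auto simp: s_def)
qed

lemma write_output_spec:
  fixes \<sigma> :: "'a::ring_1 mem"
  assumes "fst \<sigma> rN2 = N" "fst \<sigma> rC = b" "fst \<sigma> one_reg = 1" "N \<le> b"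
  shows "\<forall>x<N. snd (sem write_output \<sigma>) x = snd \<sigma> (b + x)"
  unfolding write_output_def
proof (rule For_rule[where I = "\<lambda>i \<tau>. (\<forall>x<N. N \<le> x + i \<longrightarrow> snd \<tau> x = snd \<sigma> (b + x)) \<and>
    (\<forall>a\<ge>b. 0 < a \<longrightarrow> snd \<tau> a = snd \<sigma> a)"], goal_cases)
  case 1
  show ?case by auto
next
  case 2
  show ?case using assms by auto
next
  case (3 i \<tau>)
  have i: "i < N" using 3(1) assms by simp
  have fr: "fst \<tau> 23 = N" "fst \<tau> 7 = b" "fst \<tau> 2 = 1" using 3(3) assms by auto
  define y where "y = N - 1 - i"
  have y: "y < N" "b + y > 0" using i assms by (auto simp: y_def)
  have eq: "snd (sem (Do [NOp NSub rD rN2 one_reg, NOp NSub rD rD rX,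
    NOp NAdd rT rC rD, RLoad 0 rT, RStore rD 0]) (set_reg rX i \<tau>)) =
    (snd \<tau>)(0 := snd \<tau> (b + y), y := snd \<tau> (b + y))"
    by (simp add: fr y_def)
  have v: "snd \<tau> (b + y) = snd \<sigma> (b + y)" using 3(2) y by auto
  \<comment> \<open>Every round also overwrites the scratch cell 0. The invariant speaks about it
    only after the last round, in which \<open>y\<close> is 0.\<close>
  have "snd \<sigma> (b + y) = snd \<sigma> (b + x)" if "x = 0" "x < N" "N \<le> x + Suc i" for x
    using that i by (simp add: y_def)
  moreover have "N \<le> x + i" if "N \<le> x + Suc i" "x \<noteq> y" for x
    using that by (simp add: y_def)
  ultimately show ?case
    unfolding eq v using 3(2) y assms(4) by (auto simp: fun_upd_def)
next
  case (4 \<tau>)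
  then show ?case using assms by auto
qed

section \<open>Parameters: enough primes, few heavy rows\<close>

lemma length_primes_below_lower_bound:
  assumes l: "1 \<le> l" and s: "1 \<le> s" "s < 2 ^ l"
  shows "2 * (s * l) < length (primes_below (8 * s * l * l + 2))"
proof -
  define m where "m = 4 * (s * l * l) + 1"
  have m: "8 * s * l * l + 2 = 2 * m" by (simp add: m_def)
  obtain y where y: "(2::nat) ^ l = 2 * y" "l \<le> y"
  proof
    show "(2::nat) ^ l = 2 * 2 ^ (l - 1)" using l by (cases l) auto
    show "l \<le> 2 ^ (l - 1)" using less_exp[of "l - 1"] by linarith
  qed
  \<comment> \<open>This justifies the exponent \<open>4 * l\<close> in the Chebyshev bound:
    \<open>s < 2 * y\<close> and \<open>l \<le> y\<close> keep \<open>2 * m\<close> below (2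
    y)^4.\<close>
  have "2 * m \<le> 2 ^ (4 * l)"
  proof -
    have y1: "1 \<le> y" using l y by simp
    have "s * (l * l) \<le> (2 * y - 1) * (y * y)"
      using s(2) y by (intro mult_mono) auto
    then have "2 * m \<le> 8 * ((2 * y - 1) * (y * y)) + 2" by (simp add: m_def mult.assoc)
    also have "\<dots> \<le> 16 * (y * y * y)"
    proof -
      have "1 * 1 \<le> y * y" using y1 by (intro mult_mono) auto
      moreover have "(2 * y - 1) * (y * y) + y * y = 2 * (y * y * y)"
        using y1 by (cases y) (auto simp: algebra_simps)
      ultimately show ?thesis by linarith
    qed
    also have "\<dots> \<le> 16 * (y * y * y * y)" using y1 by simp
    also have "\<dots> = (2 ^ l) ^ 4" unfolding y(1) by (simp add: power4_eq_xxxx)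
    also have "\<dots> = 2 ^ (4 * l)" by (simp add: power_mult[symmetric] mult.commute)
    finally show ?thesis .
  qed
  then have "2 * m \<le> 4 * l * card {p. prime p \<and> p \<le> 2 * m} + 1"
    by (intro card_primes_lower_bound) (auto simp: m_def)
  \<comment> \<open>The Chebyshev bound counts primes up to \<open>2 * m\<close>, the list only
    those below; the even number \<open>2 * m > 2\<close> is not prime.\<close>
  moreover have "{p. prime p \<and> p \<le> 2 * m} = set (primes_below (2 * m))"
  proof -
    have "\<not> prime (2 * m)"
    proof
      assume "prime (2 * m)"
      then have "m = 1" using prime_product[of 2 m] by auto
      then show False using l s by (simp add: m_def)
    qed
    then show ?thesis by (auto simp: primes_below_def le_less)
  qed
  moreover have "card (set (primes_below (2 * m))) = length (primes_below (2 * m))"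
    by (rule distinct_card) (simp add: primes_below_def)
  ultimately have "2 * m \<le> 4 * l * length (primes_below (2 * m)) + 1" by (simp only:)
  \<comment> \<open>The origin of the modulus bound: its 8 is the 4 of the exponent times the 2 of
    the majority, and its summand 2 exceeds the 1 lost in the Chebyshev bound.\<close>
  moreover have "2 * m = 4 * l * (2 * (s * l)) + 2" by (simp add: m_def)
  ultimately have "4 * l * (2 * (s * l)) < 4 * l * length (primes_below (2 * m))" by linarith
  then show ?thesis unfolding m by (simp add: mult.commute)
qed

text \<open>Double counting: each heavy row contributes more than \<open>s\<close> to a total below
  \<open>s * s\<close>.\<close>

lemma card_heavy_rows:
  fixes k s n :: nat
  assumes "card {(i, j). i < n \<and> j < n \<and> P i j} \<le> k" "k < s * s"
  shows "card {i. i < n \<and> s < card {j. j < n \<and> P i j}} \<le> s"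
proof -
  let ?H = "{i. i < n \<and> s < card {j. j < n \<and> P i j}}"
  have "{(i, j). i < n \<and> j < n \<and> P i j} = Sigma {..<n} (\<lambda>i. {j. j < n \<and> P i j})" by auto
  then have "card {(i, j). i < n \<and> j < n \<and> P i j} = (\<Sum>i<n. card {j. j < n \<and> P i j})"
    by simp
  moreover have "(\<Sum>i\<in>?H. s) \<le> (\<Sum>i\<in>?H. card {j. j < n \<and> P i j})" by (rule sum_mono) auto
  moreover have "\<dots> \<le> (\<Sum>i<n. card {j. j < n \<and> P i j})" by (rule sum_mono2) auto
  moreover have "(\<Sum>i\<in>?H. s) = card ?H * s" by simp
  ultimately have "card ?H * s < s * s" using assms by linarith
  then show ?thesis by simp
qed

locale correction_input =
  fixes n k :: nat and A B C :: "nat \<Rightarrow> nat \<Rightarrow> 'a::ring_1" and \<sigma> :: "'a mem"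
  assumes regs0: "fst \<sigma> rN = n" "fst \<sigma> rK = k" "fst \<sigma> rZ = 0" "fst \<sigma> one_reg = 1"
    and mem0: "\<And>x. x < n * n \<Longrightarrow> snd \<sigma> x = A (x div n) (x mod n)"
      "\<And>x. x < n * n \<Longrightarrow> snd \<sigma> (x + n * n) = B (x div n) (x mod n)"
      "\<And>x. x < n * n \<Longrightarrow> snd \<sigma> (x + 2 * (n * n)) = C (x div n) (x mod n)"
begin

definition T :: nat where "T = 3 * (n * n) + 4"

abbreviation "\<sigma>1 \<equiv> sem init_regs \<sigma>"
abbreviation "\<sigma>2 \<equiv> sem relocate \<sigma>1"
abbreviation "\<sigma>3 \<equiv> sem compute_log \<sigma>2"
abbreviation "\<sigma>4 \<equiv> sem compute_sqrt \<sigma>3"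

definition \<sigma>5 :: "'a mem" where "\<sigma>5 = sem compute_modulus_bound \<sigma>4"

definition l :: nat where "l = fst \<sigma>3 rLog"
definition s :: nat where "s = fst \<sigma>4 rS"
definition M :: nat where "M = 8 * s * l * l + 2"

lemmas regs1 = init_regs_spec[OF regs0, folded T_def]

lemma \<sigma>5_eq: "\<sigma>5 = sem preamble \<sigma>"
  by (simp add: \<sigma>5_def preamble_def)

lemma l_bounds: "n + k + 2 \<le> 2 ^ l" "1 \<le> l" "2 ^ (l - 1) < n + k + 2"
proof -
  have c: "fst \<sigma>2 rPow = 1" "fst \<sigma>2 rLog = 0" "fst \<sigma>2 one_reg = 1" "fst \<sigma>2 rNK = n + k + 2"
    using regs0 regs1 by simp_all
  note spec = compute_log_spec[OF c, folded l_def]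
  show "n + k + 2 \<le> 2 ^ l" by (rule spec(1))
  then show "1 \<le> l" by (cases l) auto
  then show "2 ^ (l - 1) < n + k + 2" using spec(2) by simp
qed

lemma s_bounds: "k < s * s" "(s - 1) * (s - 1) \<le> k" "1 \<le> s" "s < 2 ^ l"
proof -
  have c: "fst \<sigma>3 rS = 0" "fst \<sigma>3 one_reg = 1" "fst \<sigma>3 rK1 = k + 1"
    using regs0 regs1 by simp_all
  note spec = compute_sqrt_spec[OF c, folded s_def]
  show "k < s * s" "(s - 1) * (s - 1) \<le> k" by (rule spec)+
  then show "1 \<le> s" by (cases s) auto
  \<comment> \<open>Gives \<open>s \<le> k + 1\<close>; since \<open>k\<close> is included in the
    argument of the logarithm, \<open>s\<close> is below \<open>2 ^ l\<close>.\<close>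
  have "s - 1 \<le> (s - 1) * (s - 1)" by (cases "s - 1") auto
  then have "s \<le> k + 1" using \<open>(s - 1) * (s - 1) \<le> k\<close> by linarith
  then show "s < 2 ^ l" using l_bounds(1) by linarith
qed

lemma snd_\<sigma>5: "x < 3 * (n * n) \<Longrightarrow> snd \<sigma>5 (x + T) = snd \<sigma> x"
proof -
  assume x: "x < 3 * (n * n)"
  have "fst \<sigma>1 rG = 3 * (n * n) - 4" "fst \<sigma>1 rT = 4" "fst \<sigma>1 rA = 3 * (n * n) + 4"
    "\<forall>x<4. snd \<sigma>1 (x + (3 * (n * n) + 4)) = snd \<sigma> x" "\<forall>a<3 * (n * n). 4 \<le> a \<longrightarrow> snd \<sigma>1 a = snd \<sigma> a"
    using regs1 by (simp_all add: T_def)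
  then have "snd \<sigma>2 (x + T) = snd \<sigma> x" using relocate_spec[of \<sigma>1 "3 * (n * n)"] x by (simp add: T_def)
  moreover have "snd \<sigma>3 = snd \<sigma>2"
    by (rule compute_log_spec(3)[where N = "n + k + 2"]) (use regs0 regs1 in simp_all)
  moreover have "snd \<sigma>4 = snd \<sigma>3"
    by (rule compute_sqrt_spec(3)[where k = k]) (use regs0 regs1 in simp_all)
  ultimately show ?thesis by (simp add: \<sigma>5_def compute_modulus_bound_def)
qed

lemma fst_\<sigma>5: "fst \<sigma>5 rN = n" "fst \<sigma>5 one_reg = 1" "fst \<sigma>5 rM = M" "fst \<sigma>5 rZ = 0" "fst \<sigma>5 rA = T"
    "fst \<sigma>5 rB = T + n * n" "fst \<sigma>5 rC = T + 2 * (n * n)" "fst \<sigma>5 rY = T + 3 * (n * n)"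
    "fst \<sigma>5 rV = T + 3 * (n * n) + n" "fst \<sigma>5 rRS = n" "fst \<sigma>5 rCS = 1" "fst \<sigma>5 rN2 = n * n"
proof -
  have "fst \<sigma>4 rLog = l" "fst \<sigma>4 rS = s" by (simp_all add: l_def s_def)
  then show "fst \<sigma>5 rM = M" by (simp add: \<sigma>5_def compute_modulus_bound_def M_def)
qed (use regs0 regs1 in \<open>simp_all add: \<sigma>5_def\<close>)

definition \<sigma>6 :: "'a mem" where "\<sigma>6 = sem (phase True) \<sigma>5"
definition \<sigma>7 :: "'a mem" where "\<sigma>7 = sem transpose_layout \<sigma>6"
definition \<sigma>8 :: "'a mem" where "\<sigma>8 = sem (phase False) \<sigma>7"

lemma sem_correction: "sem correction \<sigma> = sem write_output \<sigma>8"
  by (simp add: correction_def \<sigma>8_def \<sigma>7_def \<sigma>6_def \<sigma>5_eq)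

lemma snd_sem_correction:
  assumes "num_diff n C (mat_mult n A B) \<le> k" "i < n" "j < n"
  shows "snd (sem correction \<sigma>) (i * n + j) = mat_mult n A B i j"
proof -
  \<comment> \<open>Two views of the same memory: row-major, and transposed with the factors
    exchanged.\<close>
  interpret L1: layout n M n 1 T "T + n * n" "T + 2 * (n * n)" "T + 3 * (n * n)" "T + 3 * (n * n) + n"
    by unfold_locales (auto simp: T_def)
  interpret L2: layout n M 1 n "T + n * n" T "T + 2 * (n * n)" "T + 3 * (n * n)" "T + 3 * (n * n) + n"
    by unfold_locales (auto simp: T_def)
  have n: "n \<le> 2 ^ l" using l_bounds(1) by linarith
  have primes: "2 * (s * l) < length (primes_below M)"
    unfolding M_def by (rule length_primes_below_lower_bound) (use l_bounds s_bounds in auto)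
  have regs5: "L1.regs \<sigma>5" unfolding L1.regs_def by (simp add: fst_\<sigma>5)
  have mats5: "L1.mats \<sigma>5 A B C"
  proof -
    have "snd \<sigma>5 (i * n + j + T) = A i j \<and> snd \<sigma>5 (i * n + j + (T + n * n)) = B i j \<and>
        snd \<sigma>5 (i * n + j + (T + 2 * (n * n))) = C i j" if "i < n" "j < n" for i j
    proof -
      have x: "i * n + j < n * n" using that by (rule mult_add_less)
      have "(i * n + j) div n = i" "(i * n + j) mod n = j" using that by auto
      then show ?thesis
        using snd_\<sigma>5[of "i * n + j"] snd_\<sigma>5[of "i * n + j + n * n"] snd_\<sigma>5[of "i * n + j + 2 * (n * n)"]
          mem0[OF x] x by (simp add: add_ac)
    qed
    then show ?thesis unfolding L1.mats_def L1.off_def by simp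
  qed
  obtain C1 where C1: "L1.mats \<sigma>6 A B C1"
    and light: "\<And>i j. i < n \<Longrightarrow> j < n \<Longrightarrow> card {j. j < n \<and> L1.err True A B C i j \<noteq> 0} \<le> s
      \<Longrightarrow> L1.err True A B C1 i j = 0"
    by (rule L1.phase_spec[OF regs5 mats5 n primes, where f = True, folded \<sigma>6_def]) blast
  let ?At = "\<lambda>i j. A j i" and ?Bt = "\<lambda>i j. B j i"
  \<comment> \<open>Reversed multiplication undoes the exchange of the factors, so this holds
    without commutativity.\<close>
  have err_transpose: "L2.err False ?Bt ?At (\<lambda>i j. D j i) i j = L1.err True A B D j i" for D i j
    unfolding L1.err_def by (simp add: mul_def)
  have fst6: "fst \<sigma>6 x = fst \<sigma>5 x" if "x \<notin> writes (phase True)" for x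
    unfolding \<sigma>6_def using that by (intro fst_sem) auto
  have fst7: "fst \<sigma>7 rN = n" "fst \<sigma>7 one_reg = 1" "fst \<sigma>7 rM = M" "fst \<sigma>7 rZ = 0" "fst \<sigma>7 rA = T + n * n"
    "fst \<sigma>7 rB = T" "fst \<sigma>7 rC = T + 2 * (n * n)" "fst \<sigma>7 rY = T + 3 * (n * n)"
    "fst \<sigma>7 rV = T + 3 * (n * n) + n" "fst \<sigma>7 rRS = 1" "fst \<sigma>7 rCS = n" "fst \<sigma>7 rN2 = n * n"
    by (simp_all add: \<sigma>7_def transpose_layout_def fst6 fst_\<sigma>5)
  have regs7: "L2.regs \<sigma>7" unfolding L2.regs_def using fst7 by simp
  have mats7: "L2.mats \<sigma>7 ?Bt ?At (\<lambda>i j. C1 j i)"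
    using C1 unfolding L1.mats_def L2.mats_def L1.off_def L2.off_def
    by (simp add: \<sigma>7_def transpose_layout_def add_ac)
  obtain C2 where C2: "L2.mats \<sigma>8 ?Bt ?At C2"
    and light2: "\<And>i j. i < n \<Longrightarrow> j < n \<Longrightarrow> card {j. j < n \<and> L2.err False ?Bt ?At (\<lambda>i j. C1 j i) i j \<noteq> 0} \<le> s
      \<Longrightarrow> L2.err False ?Bt ?At C2 i j = 0"
    by (rule L2.phase_spec[OF regs7 mats7 n primes, where f = False, folded \<sigma>8_def]) blast
  \<comment> \<open>By \<open>light\<close>, an error that survives the first phase lies in a row
    that was heavy before it, so a column meets at most one surviving error per heavy row.\<close>
  have "card {i. i < n \<and> L1.err True A B C1 i j \<noteq> 0} \<le> s" if "j < n" for j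
  proof -
    have err: "L1.err True A B C i j \<noteq> 0 \<longleftrightarrow> C i j \<noteq> mat_mult n A B i j" for i j
      by (simp add: L1.err_def mat_mult_def mul_def)
    have "card {i. i < n \<and> s < card {j. j < n \<and> L1.err True A B C i j \<noteq> 0}} \<le> s"
      unfolding err using assms(1) s_bounds(1) unfolding num_diff_def by (rule card_heavy_rows)
    moreover have "card {i. i < n \<and> L1.err True A B C1 i j \<noteq> 0}
        \<le> card {i. i < n \<and> s < card {j. j < n \<and> L1.err True A B C i j \<noteq> 0}}"
    proof (rule card_mono)
      show "{i. i < n \<and> L1.err True A B C1 i j \<noteq> 0}
          \<subseteq> {i. i < n \<and> s < card {j. j < n \<and> L1.err True A B C i j \<noteq> 0}}"
        using light \<open>j < n\<close> leI by blast
    qed simp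
    ultimately show ?thesis by linarith
  qed
  then have "L1.err True A B (\<lambda>i j. C2 j i) i j = 0"
    using light2[of j i] assms(2,3) unfolding err_transpose[of _ j i, symmetric]
    by (simp add: err_transpose)
  then have "C2 j i = mat_mult n A B i j" by (simp add: L1.err_def mat_mult_def mul_def)
  moreover have "snd \<sigma>8 (j + i * n + (T + 2 * (n * n))) = C2 j i"
    using C2 assms(2,3) unfolding L2.mats_def L2.off_def by simp
  moreover have "snd (sem write_output \<sigma>8) (i * n + j) = snd \<sigma>8 (T + 2 * (n * n) + (i * n + j))"
  proof -
    have "fst \<sigma>8 rN2 = n * n" "fst \<sigma>8 rC = T + 2 * (n * n)" "fst \<sigma>8 one_reg = 1"
      unfolding \<sigma>8_def using fst7 by simp_all
    then show ?thesis using write_output_spec[of \<sigma>8 "n * n"] mult_add_less[OF assms(2,3)] by simp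
  qed
  ultimately show ?thesis by (simp add: sem_correction add_ac)
qed

section \<open>Running time\<close>

lemma phase_cost_bound:
  assumes "fst \<tau> rN = n" "fst \<tau> rM = M"
  shows "cost (phase f) \<tau> \<le> 200 * ((n + 1)\<^sup>2 * (M + 1)\<^sup>2)"
proof -
  \<comment> \<open>The loop over residues below \<open>rP\<close> sits inside the loop over
    \<open>rP\<close> below \<open>rM\<close>; each is bounded by \<open>M\<close>, which yields the
    square.\<close>
  have fb: "free_bounds (phase f) = {rN, rM}"
    by (auto simp: phase_def collect_votes_def apply_votes_def majority_def prime_test_def bucket_def
      bucket_sum_def dot_def bucket_store_def)
  have "cost (phase f) \<tau> \<le> cost_bound (phase f) (fst \<tau>)"
    by (rule cost_le_cost_bound) (auto simp: fb)
  also have "\<dots> \<le> 200 * ((n + 1)\<^sup>2 * (M + 1)\<^sup>2)"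
    using assms by (simp add: phase_def collect_votes_def apply_votes_def majority_def prime_test_def bucket_def
      bucket_sum_def dot_def bucket_store_def algebra_simps power2_eq_square)
  finally show ?thesis .
qed

lemma preamble_cost_bound: "cost preamble \<sigma> \<le> 100 * ((k + 1) * (n + 1)\<^sup>2)"
proof -
  have "cost relocate \<sigma>1 \<le> cost_bound relocate (fst \<sigma>1)"
    by (rule cost_le_cost_bound) (auto simp: relocate_def)
  also have "\<dots> \<le> 21 * (n * n) + 3" using regs1 by (simp add: relocate_def)
  finally have 1: "cost relocate \<sigma>1 \<le> 21 * (n * n) + 3" .
  have "cost compute_log \<sigma>2 \<le> cost_bound compute_log (fst \<sigma>2)"
    by (rule cost_le_cost_bound) (auto simp: compute_log_def)
  also have "\<dots> = 7 * (n + k + 2) + 3" using regs1 by (simp add: compute_log_def)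
  finally have 2: "cost compute_log \<sigma>2 \<le> 7 * (n + k + 2) + 3" .
  have "cost compute_sqrt \<sigma>3 \<le> cost_bound compute_sqrt (fst \<sigma>3)"
    by (rule cost_le_cost_bound) (auto simp: compute_sqrt_def)
  also have "\<dots> = 7 * (k + 1) + 3" using regs1 by (simp add: compute_sqrt_def)
  finally have 3: "cost compute_sqrt \<sigma>3 \<le> 7 * (k + 1) + 3" .
  \<comment> \<open>The 31 straight-line steps are 25 of \<open>init_regs\<close> and 6 of
    \<open>compute_modulus_bound\<close>.\<close>
  have "cost preamble \<sigma> = 31 + cost relocate \<sigma>1 + cost compute_log \<sigma>2 + cost compute_sqrt \<sigma>3"
    by (simp add: preamble_def init_regs_def[THEN arg_cong, of "\<lambda>c. cost c \<sigma>"]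
      compute_modulus_bound_def[THEN arg_cong, of "\<lambda>c. cost c \<sigma>4"])
  also have "\<dots> \<le> 31 + (21 * (n * n) + 3) + (7 * (n + k + 2) + 3) + (7 * (k + 1) + 3)"
    using 1 2 3 by (intro add_mono order_refl)
  also have "\<dots> \<le> 100 * ((k + 1) * (n + 1)\<^sup>2)" by (simp add: algebra_simps power2_eq_square)
  finally show ?thesis .
qed

lemma correction_cost_bound: "cost correction \<sigma> + 1 \<le> 97000 * ((k + 1) * (n + 1)\<^sup>2 * l ^ 4)"
proof -
  define X where "X = (n + 1)\<^sup>2"
  have fst6: "fst \<sigma>6 x = fst \<sigma>5 x" if "x \<notin> writes (phase True)" for x
    unfolding \<sigma>6_def using that by (intro fst_sem) auto
  have fst7: "fst \<sigma>7 rN = n" "fst \<sigma>7 rM = M" "fst \<sigma>7 rN2 = n * n"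
    by (simp_all add: \<sigma>7_def transpose_layout_def fst6 fst_\<sigma>5)
  have "cost write_output \<sigma>8 \<le> cost_bound write_output (fst \<sigma>8)"
    by (rule cost_le_cost_bound) (auto simp: write_output_def)
  also have "\<dots> = 8 * (n * n) + 3"
    using fst7 by (simp add: write_output_def \<sigma>8_def)
  also have "\<dots> \<le> 8 * X" by (simp add: X_def power2_eq_square)
  finally have out: "cost write_output \<sigma>8 \<le> 8 * X" .
  \<comment> \<open>Of the 6 steps, 5 are those of \<open>transpose_layout\<close> and 1 is the
    instruction that sets \<open>one_reg\<close>.\<close>
  have "cost correction \<sigma> + 1 = cost preamble \<sigma> + cost (phase True) \<sigma>5 + cost (phase False) \<sigma>7
      + cost write_output \<sigma>8 + 6"
    by (simp add: correction_def \<sigma>8_def \<sigma>7_def \<sigma>6_def \<sigma>5_eq transpose_layout_def)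
  also have "\<dots> \<le> 100 * ((k + 1) * X) + 200 * (X * (M + 1)\<^sup>2) + 200 * (X * (M + 1)\<^sup>2) + 8 * X + 6 * X"
    using preamble_cost_bound out phase_cost_bound[of \<sigma>5 True] phase_cost_bound[of \<sigma>7 False] fst7 fst_\<sigma>5
    unfolding X_def[symmetric] by (intro add_mono) (auto simp: X_def)
  also have "\<dots> \<le> 114 * ((k + 1) * X) + 400 * (X * (M + 1)\<^sup>2)" by simp
  \<comment> \<open>The factor 242 is 2 * 11^2: the 11 absorbs \<open>M + 1\<close> = 8 s l^2 + 3,
    and the 2 comes from bounding \<open>s * s\<close> by \<open>k + 1\<close>.\<close>
  also have "(M + 1)\<^sup>2 \<le> 242 * ((k + 1) * l ^ 4)"
  proof -
    have "1 * (1 * 1) \<le> s * (l * l)" using s_bounds(3) l_bounds(2) by (intro mult_mono) auto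
    then have "M + 1 \<le> 11 * (s * (l * l))" by (simp add: M_def mult.assoc)
    then have "(M + 1)\<^sup>2 \<le> (11 * (s * (l * l)))\<^sup>2" by (rule power_mono) simp
    also have "\<dots> = 121 * (s * s * l ^ 4)" by (simp add: power2_eq_square power4_eq_xxxx)
    also have "s * s \<le> 2 * (k + 1)"
    proof -
      obtain r where r: "s = Suc r" using s_bounds(3) by (cases s) auto
      \<comment> \<open>Nonnegativity of (r - 1)^2. With \<open>r * r \<le> k\<close>, the
        minimality of \<open>s\<close>, it gives (r + 1)^2 \<le> 2 k + 2.\<close>
      have "2 * r \<le> r * r + 1" by (cases r) auto
      then show ?thesis using s_bounds(2) r by simp
    qed
    finally show ?thesis by simp
  qed
  also have "114 * ((k + 1) * X) + 400 * (X * (242 * ((k + 1) * l ^ 4)))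
      \<le> 114 * ((k + 1) * X * l ^ 4) + 400 * (X * (242 * ((k + 1) * l ^ 4)))"
  proof -
    have "(k + 1) * X * 1 \<le> (k + 1) * X * l ^ 4" using l_bounds(2) by (intro mult_left_mono) auto
    then show ?thesis by (intro add_right_mono mult_left_mono) simp_all
  qed
  \<comment> \<open>The exact factor is 114 + 400 * 242 = 96914.\<close>
  also have "\<dots> \<le> 97000 * ((k + 1) * X * l ^ 4)" by (simp add: algebra_simps)
  finally show ?thesis by (simp add: X_def)
qed

text \<open>One factor 2 absorbs the 1 in \<open>l - 1\<close>, as \<open>ln 2\<close> is itself at
  most the right-hand logarithm; the other comes from \<open>ln 2\<close> being at least
  1/2.\<close>

lemma l_le_ln: "real l \<le> 4 * ln (real (n + k + 2))"
proof -
  let ?N = "n + k + 2"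
  have "real (l - 1) * ln 2 = ln (real (2 ^ (l - 1)))" by (simp add: ln_realpow)
  also have "\<dots> \<le> ln (real ?N)"
  proof (rule ln_mono)
    show "real (2 ^ (l - 1)) \<le> real ?N" using l_bounds(3) by (simp only: of_nat_le_iff less_imp_le)
  qed auto
  finally have "real (l - 1) * ln 2 \<le> ln (real ?N)" .
  moreover have "ln 2 \<le> ln (real ?N)" by (intro ln_mono) auto
  moreover have "real l * ln 2 = real (l - 1) * ln 2 + ln 2"
    using l_bounds(2) by (simp add: of_nat_diff algebra_simps)
  moreover have "(1 / 2 :: real) \<le> ln 2"
    using ln_le_minus_one[of "1 / 2 :: real"] by (simp add: ln_div)
  then have "real l * (1 / 2) \<le> real l * ln 2" by (intro mult_left_mono) auto
  ultimately show ?thesis by linarith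
qed

end

theorem theorem2:
  "\<exists>(P :: instr list) (c :: real) (d :: nat).
     \<forall>(n :: nat) (k :: nat) (A :: nat \<Rightarrow> nat \<Rightarrow> 'a::ring_1) B C'.
       num_diff n C' (mat_mult n A B) \<le> k \<longrightarrow>
       (\<exists>t. halted P (run P t (init_state n k A B C'))
            \<and> outputs n (run P t (init_state n k A B C')) (mat_mult n A B)
            \<and> real t \<le> c * real (k + 1) * real ((n + 1) ^ 2) * (ln (real (n + k + 2))) ^ d)"
proof (rule exI[of _ correction_program], rule exI[of _ "97000 * 4 ^ 4"], rule exI[of _ 4],
    intro allI impI)
  fix n k :: nat and A B C' :: "nat \<Rightarrow> nat \<Rightarrow> 'a"
  assume diff: "num_diff n C' (mat_mult n A B) \<le> k"
  let ?P = correction_program and ?s = "init_state n k A B C'"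
  define \<sigma> :: "'a mem" where "\<sigma> = set_reg one_reg 1 (snd ?s)"
  interpret correction_input n k A B C' \<sigma>
    by unfold_locales (auto simp: \<sigma>_def init_state_def)
  have "run ?P 1 ?s = (1, \<sigma>)"
    by (simp add: run_def step_def halted_def init_state_def correction_program_def \<sigma>_def set_reg_def)
  moreover have "run ?P (cost correction \<sigma>) (1, \<sigma>) = (1 + code_size correction, sem correction \<sigma>)"
  proof (rule run_compile[OF wf_correction])
    have "?P = [NConst one_reg 1] @ compile 1 correction @ []" by (simp add: correction_program_def)
    then show "code_at ?P 1 (compile 1 correction)" unfolding code_at_def by (metis length_Cons list.size(3) One_nat_def)
  qed (simp add: \<sigma>_def)
  ultimately have run: "run ?P (1 + cost correction \<sigma>) ?s = (1 + code_size correction, sem correction \<sigma>)"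
    by (rule run_trans)
  have "halted ?P (run ?P (1 + cost correction \<sigma>) ?s)"
    unfolding run by (simp add: halted_def correction_program_def)
  moreover have "outputs n (run ?P (1 + cost correction \<sigma>) ?s) (mat_mult n A B)"
    unfolding run outputs_def using snd_sem_correction[OF diff] by simp
  \<comment> \<open>The exponent 4 arises because \<open>M\<close> contains \<open>l\<close> twice
    and is squared; the factor 4 ^ 4 is the price of replacing \<open>l\<close> by the natural
    logarithm.\<close>
  moreover have "real (1 + cost correction \<sigma>)
      \<le> 97000 * 4 ^ 4 * real (k + 1) * real ((n + 1) ^ 2) * ln (real (n + k + 2)) ^ 4"
  proof -
    have "real (1 + cost correction \<sigma>) \<le> real (97000 * ((k + 1) * (n + 1)\<^sup>2 * l ^ 4))"
      using correction_cost_bound by (simp only: of_nat_le_iff add.commute)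
    also have "\<dots> = 97000 * real (k + 1) * real ((n + 1)\<^sup>2) * real l ^ 4"
      by (simp only: of_nat_mult of_nat_power of_nat_numeral mult.assoc)
    also have "\<dots> \<le> 97000 * real (k + 1) * real ((n + 1)\<^sup>2) * (4 * ln (real (n + k + 2))) ^ 4"
      using l_le_ln by (intro mult_left_mono power_mono) auto
    also have "\<dots> = (97000 * 4 ^ 4) * real (k + 1) * real ((n + 1) ^ 2) * ln (real (n + k + 2)) ^ 4"
      by (simp only: power_mult_distrib mult_ac)
    finally show ?thesis .
  qed
  ultimately show "\<exists>t. halted ?P (run ?P t ?s) \<and> outputs n (run ?P t ?s) (mat_mult n A B) \<and>
      real t \<le> 97000 * 4 ^ 4 * real (k + 1) * real ((n + 1) ^ 2) * ln (real (n + k + 2)) ^ 4"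
    by blast
qed

end
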